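(* If the assignment $\rho$ used in the two-step algorithm of the context is the one produced by the greedy procedure described there, then the expected squared error $\mathbb{E}[(\tilde k-f(G))^2]$ is $$O\!\left(\frac{d_{\max}}{\varepsilon_2^2}m+\frac{|\Delta|^2}{\varepsilon_1^2}+\frac{C'_{\mathrm{OPT}}}{\varepsilon_1}\right)$$ when the biased estimator is used, and $$O\!\left(\frac{d_{\max}}{\varepsilon_1^4\varepsilon_2^2}m+\frac{|\Delta|}{\varepsilon_1^3}+\frac{C'_{\mathrm{OPT}}}{\varepsilon_1^3}\right)$$ when the unbiased estimator is used.
   Context: Let $G=(V,E,w)$ be a finite simple undirected graph, $V=\{1,\dots,n\}$, $m=|E|$, maximum degree $d_{\max}$, integer weights $w_{uv}=w_{vu}$; $\mathcal N(v)$ is the neighborhood of $v$, $w^v=(w_{vu})_{u\in\mathcal N(v)}$. Let $\Delta$ be the set of triangles, $w_T$ the sum of the three edge weights of $T$, $\lambda\in\mathbb{Z}$, $f(G)=|\{T\in\Delta:w_T<\lambda\}|$. Let $\varepsilon_1,\varepsilon_2>0$, $p=e^{-\varepsilon_1}$; $\mathrm{DLap}(p)$ has mass $\frac{1-p}{1+p}p^{|i|}$ at $i\in\mathbb{Z}$; $\mathrm{Lap}(b)$ has density $\frac1{2b}e^{-|y|/b}$. Let $h(k)=0$ for $k>\lambda$, $h(\lambda)=-\frac{p}{(1-p)^2}$, $h(\lambda-1)=1+\frac{p}{(1-p)^2}$, $h(k)=1$ for $k<\lambda-1$. Algorithm: Step 1: each $v$ reports $\tilde w_{vu}=w_{vu}+Y_{vu}$,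 all $Y_{vu}$ i.i.d. $\mathrm{DLap}(p)$; for each edge, $w'_{uv}=w'_{vu}=\tilde w_{uv}$ if $u<v$ and $\tilde w_{vu}$ otherwise. With assignment $\rho:\Delta\to V$, $\rho(T)\in T$, $\Delta_v=\rho^{-1}(v)$. Step 2: node $v$ computes $f'_v(w^v)=\sum_{T=\{v,u,x\}\in\Delta_v}g$, where $g=\mathbf 1\{w_{vu}+w_{vx}+w'_{ux}<\lambda\}$ (biased) or $g=h(w_{vu}+w_{vx}+w'_{ux})$ (unbiased), releases $\tilde f_v=f'_v(w^v)+L_v$, $L_v\sim\mathrm{Lap}(GS(f'_v)/\varepsilon_2)$ independent, where $GS(f'_v)=\max\{|f'_v(a)-f'_v(b)|:\|a-b\|_1\le1\}$ (with the $w'$ fixed). Output $\tilde k=\sum_v\tilde f_v$. For an assignment $\rho$ and edge $e=\{x,y\}$ let $l_\rho(e)=|\{T\in\Delta:e\subseteq T,\ \rho(T)\notin e\}|$, $\#C'_4(\rho)=\sum_e\binom{l_\rho(e)}2$, and $C'_{\mathrm{OPT}}=\min_\rho\#C'_4(\rho)$ over all assignments with $\rho(T)\in T$. Greedy procedure: initialize $l(e)=0$; process triangles in any order; for the current $T$ pick an edge $e\subseteq T$ with minimum current $l(e)$ (ties arbitrary), set $\rho(T)$ to be the vertex of $T$ outside $e$, increase $l(e)$ by 1.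
   Formalization: The unbiased bound is proved for $0<\varepsilon_1\le B$, for every $B>0$, with a constant depending on $B$; one constant for all $\varepsilon_1>0$ fails (single triangle, zero weights, $\lambda=1$, large $\varepsilon_1$, small $\varepsilon_2$). *)

theory Defs
  imports "HOL-Probability.Probability"
begin

section \<open>Weighted graphs and triangles\<close>

text \<open>
  A simple undirected graph on \<open>{1..n}\<close> is given by its set \<open>E\<close> of two-element edges.
  The weight of the edge \<open>{u, v}\<close> is \<open>w u v = w v u\<close>; values of \<open>w\<close> off the edges are never used.
\<close>

definition weighted_graph :: "nat \<Rightarrow> nat set set \<Rightarrow> (nat \<Rightarrow> nat \<Rightarrow> int) \<Rightarrow> bool" where
  "weighted_graph n E w \<longleftrightarrow>
     (\<forall>e\<in>E. e \<subseteq> {1..n} \<and> card e = 2) \<and> (\<forall>u v. {u, v} \<in> E \<longrightarrow> w u v = w v u)"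

definition nbhd :: "nat set set \<Rightarrow> nat \<Rightarrow> nat set" where
  "nbhd E v = {u. {v, u} \<in> E}"

definition max_degree :: "nat \<Rightarrow> nat set set \<Rightarrow> nat" where
  "max_degree n E = Max ((\<lambda>v. card (nbhd E v)) ` {1..n})"

definition triangles :: "nat set set \<Rightarrow> nat set set" where
  "triangles E = {T. card T = 3 \<and> (\<forall>u\<in>T. \<forall>v\<in>T. u \<noteq> v \<longrightarrow> {u, v} \<in> E)}"

definition triangle_weight :: "(nat \<Rightarrow> nat \<Rightarrow> int) \<Rightarrow> nat set \<Rightarrow> int" where
  "triangle_weight w T = (\<Sum>(u, v) \<in> {(u, v). u \<in> T \<and> v \<in> T \<and> u < v}. w u v)"

definition count_below :: "nat set set \<Rightarrow> (nat \<Rightarrow> nat \<Rightarrow> int) \<Rightarrow> int \<Rightarrow> nat" where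
  "count_below E w lam = card {T \<in> triangles E. triangle_weight w T < lam}"


section \<open>Assignments of triangles to vertices\<close>

definition opp_load :: "nat set set \<Rightarrow> (nat set \<Rightarrow> nat) \<Rightarrow> nat set \<Rightarrow> nat" where
  "opp_load E \<rho> e = card {T \<in> triangles E. e \<subseteq> T \<and> \<rho> T \<notin> e}"

definition num_C4 :: "nat set set \<Rightarrow> (nat set \<Rightarrow> nat) \<Rightarrow> nat" where
  "num_C4 E \<rho> = (\<Sum>e\<in>E. opp_load E \<rho> e choose 2)"

definition C4_opt :: "nat set set \<Rightarrow> nat" where
  "C4_opt E = Min (num_C4 E ` (\<Pi>\<^sub>E T\<in>triangles E. T))"

text \<open>
  \<open>greedy_run Ts l \<rho>\<close>: some resolution of ties makes the greedy procedure, after processing the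
  list \<open>Ts\<close> in this order, reach the edge counters \<open>l\<close> and the assignment \<open>\<rho>\<close>. The values of \<open>\<rho>\<close> at
  unprocessed sets are arbitrary.
\<close>

inductive greedy_run :: "nat set list \<Rightarrow> (nat set \<Rightarrow> nat) \<Rightarrow> (nat set \<Rightarrow> nat) \<Rightarrow> bool" where
  start: "greedy_run [] (\<lambda>_. 0) \<rho>"
| step: "greedy_run Ts l \<rho> \<Longrightarrow> e \<subseteq> T \<Longrightarrow> card e = 2 \<Longrightarrow>
         (\<And>e'. e' \<subseteq> T \<Longrightarrow> card e' = 2 \<Longrightarrow> l e \<le> l e') \<Longrightarrow> v \<in> T - e \<Longrightarrow>
         greedy_run (Ts @ [T]) (l(e := l e + 1)) (\<rho>(T := v))"

definition greedy_assignment :: "nat set set \<Rightarrow> (nat set \<Rightarrow> nat) \<Rightarrow> bool" where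
  "greedy_assignment E \<rho> \<longleftrightarrow>
     (\<exists>Ts l. distinct Ts \<and> set Ts = triangles E \<and> greedy_run Ts l \<rho>)"


section \<open>Noise distributions\<close>

definition DLap :: "real \<Rightarrow> int pmf" where
  "DLap p = embed_pmf (\<lambda>i. (1 - p) / (1 + p) * p ^ nat \<bar>i\<bar>)"

lemma pmf_DLap:
  assumes "0 < p" "p < 1"
  shows "pmf (DLap p) i = (1 - p) / (1 + p) * p ^ nat \<bar>i\<bar>"
  unfolding DLap_def
proof (rule pmf_embed_pmf)
  show "0 \<le> (1 - p) / (1 + p) * p ^ nat \<bar>x\<bar>" for x :: int
    using assms by simp
  let ?c = "(1 - p) / (1 + p)"
  let ?f = "\<lambda>i::int. ennreal (?c * p ^ nat \<bar>i\<bar>)"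
  have c: "?c \<ge> 0" using assms by simp
  have s1: "(\<lambda>k. ?c * p ^ k) sums (?c * (1 / (1 - p)))"
    by (intro sums_mult geometric_sums) (use assms in auto)
  have s2: "(\<lambda>k. ?c * p ^ Suc k) sums (?c * (p * (1 / (1 - p))))"
    unfolding power_Suc by (intro sums_mult geometric_sums) (use assms in auto)
  have b1: "bij_betw int UNIV {0..}"
    by (rule bij_betwI[where g = nat]) auto
  have b2: "bij_betw (\<lambda>k. - int (Suc k)) UNIV {..<0}"
    by (rule bij_betwI[where g = "\<lambda>i. nat (- i - 1)"]) auto
  have "(\<integral>\<^sup>+i. ?f i \<partial>count_space {0..}) = (\<integral>\<^sup>+k. ?f (int k) \<partial>count_space UNIV)"
    by (rule nn_integral_bij_count_space[OF b1, symmetric])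
  also have "\<dots> = (\<Sum>k. ennreal (?c * p ^ k))"
    by (simp add: nn_integral_count_space_nat)
  also have "\<dots> = ennreal (?c * (1 / (1 - p)))"
    using c assms by (intro sums_unique[symmetric] sums_ennreal[THEN iffD2] s1) auto
  finally have i1: "(\<integral>\<^sup>+i. ?f i \<partial>count_space {0..}) = ennreal (?c * (1 / (1 - p)))" .
  have "(\<integral>\<^sup>+i. ?f i \<partial>count_space {..<0}) = (\<integral>\<^sup>+k. ?f (- int (Suc k)) \<partial>count_space UNIV)"
    by (rule nn_integral_bij_count_space[OF b2, symmetric])
  also have "\<dots> = (\<integral>\<^sup>+k. ennreal (?c * p ^ Suc k) \<partial>count_space UNIV)"
    by (intro nn_integral_cong arg_cong[where f = ennreal] arg_cong2[where f = "(*)"]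
          arg_cong2[where f = "(^)"]) auto
  also have "\<dots> = (\<Sum>k. ennreal (?c * p ^ Suc k))"
    by (rule nn_integral_count_space_nat)
  also have "\<dots> = ennreal (?c * (p * (1 / (1 - p))))"
    using c assms by (intro sums_unique[symmetric] sums_ennreal[THEN iffD2] s2) auto
  finally have i2: "(\<integral>\<^sup>+i. ?f i \<partial>count_space {..<0}) = ennreal (?c * (p * (1 / (1 - p))))" .
  have "(\<integral>\<^sup>+i. ?f i \<partial>count_space UNIV) =
      (\<integral>\<^sup>+i. ?f i * indicator {0..} i + ?f i * indicator {..<0} i \<partial>count_space UNIV)"
    by (intro nn_integral_cong) (auto simp: indicator_def)
  also have "\<dots> = (\<integral>\<^sup>+i. ?f i * indicator {0..} i \<partial>count_space UNIV) +
      (\<integral>\<^sup>+i. ?f i * indicator {..<0} i \<partial>count_space UNIV)"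
    by (rule nn_integral_add) auto
  also have "\<dots> = ennreal (?c * (1 / (1 - p))) + ennreal (?c * (p * (1 / (1 - p))))"
    unfolding i1[symmetric] i2[symmetric] by (simp add: nn_integral_count_space_indicator)
  also have "\<dots> = ennreal (?c * (1 / (1 - p)) + ?c * (p * (1 / (1 - p))))"
    using c assms by (intro ennreal_plus[symmetric]) auto
  also have "?c * (1 / (1 - p)) + ?c * (p * (1 / (1 - p))) = 1"
    using assms by (simp add: divide_simps)
  finally show "(\<integral>\<^sup>+i. ?f i \<partial>count_space UNIV) = 1" by simp
qed

text \<open>
  The scale \<open>0\<close>, which occurs when a node's local function is constant, means no noise.
\<close>

definition Lap :: "real \<Rightarrow> real measure" where
  "Lap b = (if b = 0 then return borel 0
            else density lborel (\<lambda>y. ennreal (1 / (2 * b) * exp (- \<bar>y\<bar> / b))))"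

lemma prob_space_Lap:
  assumes "0 \<le> b"
  shows "prob_space (Lap b)"
proof (cases "b = 0")
  case True
  then show ?thesis by (simp add: Lap_def prob_space_return)
next
  case False
  with assms have b: "b > 0" by simp
  let ?d = "exponential_density (1 / b)"
  interpret P: prob_space "density lborel ?d"
    using b by (intro prob_space_exponential_density) simp
  have "emeasure (density lborel ?d) (space (density lborel ?d)) = 1"
    by (rule P.emeasure_space_1)
  then have e1: "(\<integral>\<^sup>+y. ennreal (?d y) \<partial>lborel) = 1"
    by (simp add: emeasure_density)
  have e2: "(\<integral>\<^sup>+y. ennreal (?d (- y)) \<partial>lborel) = 1"
    using nn_integral_real_affine[of "\<lambda>y. ennreal (?d y)" "-1" 0] e1 by simp
  have "(\<integral>\<^sup>+y. ennreal (1 / (2 * b) * exp (- \<bar>y\<bar> / b)) \<partial>lborel) =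
      (\<integral>\<^sup>+y. ennreal (1 / 2) * (ennreal (?d y) + ennreal (?d (- y))) \<partial>lborel)"
  proof (rule nn_integral_cong_AE)
    show "AE y in lborel. ennreal (1 / (2 * b) * exp (- \<bar>y\<bar> / b)) =
        ennreal (1 / 2) * (ennreal (?d y) + ennreal (?d (- y)))"
      using AE_lborel_singleton[of 0]
    proof eventually_elim
      case (elim y)
      then show ?case
        using b ennreal_mult[of "1 / 2" "exp (- \<bar>y\<bar> / b) / b"]
        by (cases "y < 0") (simp_all add: exponential_density_def)
    qed
  qed
  also have "\<dots> = ennreal (1 / 2) * (1 + 1)"
    by (simp add: nn_integral_cmult nn_integral_add e1 e2)
  also have "\<dots> = 1"
    using ennreal_mult[of "1 / 2" 2] by (simp del: ennreal_half)
  finally show ?thesis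
    using b by (auto simp: Lap_def emeasure_density intro!: prob_spaceI)
qed


section \<open>The two-step algorithm\<close>

definition biased_est :: "int \<Rightarrow> int \<Rightarrow> real" where
  "biased_est lam k = (if k < lam then 1 else 0)"

definition unbiased_est :: "real \<Rightarrow> int \<Rightarrow> int \<Rightarrow> real" where
  "unbiased_est p lam k =
     (if k > lam then 0
      else if k = lam then - (p / (1 - p)\<^sup>2)
      else if k = lam - 1 then 1 + p / (1 - p)\<^sup>2
      else 1)"

text \<open>
  Step 1: one independent noise value \<open>Y (v, u)\<close> for every ordered pair of adjacent vertices.
\<close>

definition step1_noise :: "real \<Rightarrow> nat set set \<Rightarrow> (nat \<times> nat \<Rightarrow> int) pmf" where
  "step1_noise p E = Pi_pmf {(v, u). {v, u} \<in> E} 0 (\<lambda>_. DLap p)"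

definition noisy_weight :: "(nat \<Rightarrow> nat \<Rightarrow> int) \<Rightarrow> (nat \<times> nat \<Rightarrow> int) \<Rightarrow> nat \<Rightarrow> nat \<Rightarrow> int" where
  "noisy_weight w Y u v = (if u < v then w u v + Y (u, v) else w v u + Y (v, u))"

text \<open>
  The local function of node \<open>v\<close>, for the summand \<open>g\<close>, as a function of its weight vector \<open>a\<close>, for
  fixed noisy weights \<open>w'\<close>. Each triangle \<open>{v, u, x}\<close> assigned to \<open>v\<close> is listed exactly once,
  namely with \<open>u < x\<close>.
\<close>

definition local_fun ::
  "nat set set \<Rightarrow> (nat set \<Rightarrow> nat) \<Rightarrow> (int \<Rightarrow> real) \<Rightarrow> (nat \<Rightarrow> nat \<Rightarrow> int) \<Rightarrow> nat \<Rightarrow> (nat \<Rightarrow> int) \<Rightarrow> real"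
where
  "local_fun E \<rho> g w' v a =
     (\<Sum>(u, x) \<in> {(u, x). u < x \<and> {v, u, x} \<in> triangles E \<and> \<rho> {v, u, x} = v}.
        g (a u + a x + w' u x))"

text \<open>
  Global sensitivity of a function of integer vectors indexed by \<open>I\<close>. The maximum exists for the
  local functions above, which take finitely many values since \<open>g\<close> does.
\<close>

definition GS :: "nat set \<Rightarrow> ((nat \<Rightarrow> int) \<Rightarrow> real) \<Rightarrow> real" where
  "GS I F = Max {\<bar>F a - F b\<bar> | a b.
     a \<in> (\<Pi>\<^sub>E i\<in>I. UNIV) \<and> b \<in> (\<Pi>\<^sub>E i\<in>I. UNIV) \<and> (\<Sum>i\<in>I. \<bar>a i - b i\<bar>) \<le> 1}"

text \<open>
  The distribution of the output. The scales of the second-step noise depend on the outcome \<open>Y\<close>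
  of the first step; given \<open>Y\<close>, the second-step noises are independent.
\<close>

definition two_step_output ::
  "(int \<Rightarrow> real) \<Rightarrow> real \<Rightarrow> real \<Rightarrow> nat \<Rightarrow> nat set set \<Rightarrow> (nat \<Rightarrow> nat \<Rightarrow> int) \<Rightarrow> (nat set \<Rightarrow> nat) \<Rightarrow> real measure"
where
  "two_step_output g \<epsilon>\<^sub>1 \<epsilon>\<^sub>2 n E w \<rho> =
     Giry_Monad.bind (measure_pmf (step1_noise (exp (- \<epsilon>\<^sub>1)) E)) (\<lambda>Y.
       let f' = local_fun E \<rho> g (noisy_weight w Y) in
         distr (\<Pi>\<^sub>M v\<in>{1..n}. Lap (GS (nbhd E v) (f' v) / \<epsilon>\<^sub>2)) borel
           (\<lambda>L. \<Sum>v\<in>{1..n}. f' v (restrict (w v) (nbhd E v)) + L v))"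

text \<open>Expectation in \<open>[0, \<infinity>]\<close>, so that a finite bound includes square integrability.\<close>

definition expected_sq_error :: "real measure \<Rightarrow> real \<Rightarrow> ennreal" where
  "expected_sq_error M c = (\<integral>\<^sup>+x. ennreal ((x - c)\<^sup>2) \<partial>M)"

end

theory Submission
  imports Defs
begin

text \<open>
  The Laplace noise has mean zero, so the error is the mean square of the step 1 error plus
  \<open>\<Sum>v. 2 (GS\<^sub>v / \<epsilon>\<^sub>2)\<^sup>2\<close>. Changing one weight at \<open>v\<close> by one affects at most \<open>deg v\<close> triangles, hence
  \<open>GS\<^sub>v \<le> K deg v\<close>, where \<open>K\<close> is the oscillation of the estimator, and \<open>\<Sum>v. (deg v)\<^sup>2 \<le> 2 d\<^sub>m\<^sub>a\<^sub>x m\<close>.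

  For the biased estimator a triangle contributes an error only if its opposite edge received
  nonzero noise, which has probability at most \<open>2 p \<le> 4 / \<epsilon>\<^sub>1\<^sup>2\<close>; Cauchy--Schwarz over the triangles
  suffices. For the unbiased estimator, the errors grouped by opposite edge \<open>e\<close> are centred and
  independent, so the mean square is at most \<open>\<Sum>e. l(e)\<^sup>2\<close> times a single-triangle variance
  \<open>O(1 / \<epsilon>\<^sub>1\<^sup>3)\<close>, and \<open>\<Sum>e. l(e)\<^sup>2 = |\<Delta>| + 2 #C'\<^sub>4\<close>.

  The greedy procedure is the online \<open>\<ell>\<^sub>2\<close> load balancing heuristic. If \<open>q T\<close> is the edge an optimal
  assignment picks for \<open>T\<close>, with loads \<open>o\<close>, then \<open>\<Sum>e. l(e)\<^sup>2 \<le> \<Sum>T. (2 l(q T) + 1) = 2 \<Sum>e. l(e) o(e) + |\<Delta>|\<close>,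
  and \<open>4 l o \<le> l\<^sup>2 + 4 o\<^sup>2\<close> bounds \<open>\<Sum>e. l(e)\<^sup>2\<close> by \<open>4 \<Sum>e. o(e)\<^sup>2 + 2 |\<Delta>|\<close>.
\<close>

section \<open>The greedy assignment\<close>

text \<open>
  Processing \<open>T\<close> raises the sum of squares by \<open>2 l(e) + 1 \<le> 2 l(q T) + 1\<close>, and later steps only
  increase \<open>l(q T)\<close>.
\<close>

lemma greedy_run_potential:
  assumes "greedy_run Ts l \<rho>" "distinct Ts" "\<And>T. T \<in> set Ts \<Longrightarrow> card T = 3" "finite F"
    and "\<And>T. T \<in> set Ts \<Longrightarrow> q T \<subseteq> T \<and> card (q T) = 2"
  shows "(\<forall>T\<in>set Ts. \<rho> T \<in> T) \<and> l = (\<lambda>e. card {T \<in> set Ts. T - {\<rho> T} = e}) \<and>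
    (\<Sum>e\<in>F. (l e)\<^sup>2) \<le> (\<Sum>T\<in>set Ts. 2 * l (q T) + 1)"
  using assms
proof (induction rule: greedy_run.induct)
  case (start \<rho>)
  then show ?case by simp
next
  case (step Ts l \<rho> e T v)
  have IH: "\<And>S. S \<in> set Ts \<Longrightarrow> \<rho> S \<in> S" "l = (\<lambda>e. card {T \<in> set Ts. T - {\<rho> T} = e})"
    "(\<Sum>e\<in>F. (l e)\<^sup>2) \<le> (\<Sum>T\<in>set Ts. 2 * l (q T) + 1)"
    using step by auto
  have T: "T \<notin> set Ts" using step.prems by simp
  have cT: "card T = 3" "finite T" using step.prems(2)[of T] by (auto intro: card_ge_0_finite)
  have e: "T - {v} = e"
  proof (rule card_subset_eq[symmetric])
    show "finite (T - {v})" using cT by simp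
    show "e \<subseteq> T - {v}" using step by auto
    show "card e = card (T - {v})" using step cT by auto
  qed
  \<comment> \<open>\<open>T\<close> is new, so redefining \<rho> at \<open>T\<close> leaves all
    earlier classes alone and only the class of \<open>e\<close> gains a member.\<close>
  have set_eq: "{S \<in> insert T (set Ts). S - {(\<rho>(T := v)) S} = e'} =
      {S \<in> set Ts. S - {\<rho> S} = e'} \<union> (if e' = e then {T} else {})" for e'
    using T e by (auto split: if_splits)
  have l': "(l(e := l e + 1)) = (\<lambda>e'. card {S \<in> set (Ts @ [T]). S - {(\<rho>(T := v)) S} = e'})"
  proof
    fix e'
    show "(l(e := l e + 1)) e' = card {S \<in> set (Ts @ [T]). S - {(\<rho>(T := v)) S} = e'}"
      using T set_eq[of e'] by (simp add: IH(2))
  qed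
  \<comment> \<open>Squaring \<open>l e + 1\<close> adds \<open>2 * l e + 1\<close>; this is only an
    upper bound because \<open>e\<close> may lie outside \<open>F\<close>.\<close>
  have "(\<Sum>e'\<in>F. ((l(e := l e + 1)) e')\<^sup>2) \<le> (\<Sum>e'\<in>F. (l e')\<^sup>2) + (2 * l e + 1)"
  proof -
    have "(\<Sum>e'\<in>F. ((l(e := l e + 1)) e')\<^sup>2) = (\<Sum>e'\<in>F. (l e')\<^sup>2 + (if e' = e then 2 * l e + 1 else 0))"
      by (intro sum.cong) (auto simp: power2_eq_square)
    also have "\<dots> \<le> (\<Sum>e'\<in>F. (l e')\<^sup>2) + (2 * l e + 1)"
      using step.prems(3) by (simp add: sum.distrib)
    finally show ?thesis .
  qed
  also have "\<dots> \<le> (\<Sum>S\<in>set Ts. 2 * l (q S) + 1) + (2 * l (q T) + 1)"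
    using IH(3) step.hyps(4)[of "q T"] step.prems(4)[of T] by (intro add_mono) auto
  also have "\<dots> = (\<Sum>S\<in>set (Ts @ [T]). 2 * l (q S) + 1)"
    using T by simp
  also have "\<dots> \<le> (\<Sum>S\<in>set (Ts @ [T]). 2 * (l(e := l e + 1)) (q S) + 1)"
    by (intro sum_mono) simp
  finally have "(\<Sum>e'\<in>F. ((l(e := l e + 1)) e')\<^sup>2) \<le>
    (\<Sum>S\<in>set (Ts @ [T]). 2 * (l(e := l e + 1)) (q S) + 1)" .
  moreover have "\<forall>S\<in>set (Ts @ [T]). (\<rho>(T := v)) S \<in> S"
    using IH(1) step.hyps(5) by simp
  ultimately show ?case using l' by blast
qed

section \<open>Triangles, opposite edges and loads\<close>

lemma triangleD:
  assumes "weighted_graph n E w" "T \<in> triangles E"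
  shows "card T = 3" "finite T" "T \<subseteq> {1..n}"
    and "\<And>e. e \<subseteq> T \<Longrightarrow> card e = 2 \<Longrightarrow> e \<in> E"
proof -
  show c: "card T = 3" using assms by (simp add: triangles_def)
  show "finite T" using c by (intro card_ge_0_finite) simp
  show E: "e \<in> E" if "e \<subseteq> T" "card e = 2" for e
    using that assms(2) by (auto simp: triangles_def card_2_iff)
  show "T \<subseteq> {1..n}"
  proof
    fix u assume u: "u \<in> T"
    have "card (T - {u}) = 2" using c u by simp
    then have "T - {u} \<noteq> {}" by (metis card.empty zero_neq_numeral)
    then obtain v where "v \<in> T - {u}" by blast
    then have "{u, v} \<subseteq> T" "card {u, v} = 2" using u by auto
    from E[OF this] show "u \<in> {1..n}" using assms(1) by (auto simp: weighted_graph_def)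
  qed
qed

lemma finite_edges: "weighted_graph n E w \<Longrightarrow> finite E"
  by (rule finite_subset[of _ "Pow {1..n}"]) (auto simp: weighted_graph_def)

lemma finite_triangles: "weighted_graph n E w \<Longrightarrow> finite (triangles E)"
  by (rule finite_subset[of _ "Pow {1..n}"]) (use triangleD(3) in blast)+

lemma opposite_edge:
  assumes "weighted_graph n E w" "T \<in> triangles E" "v \<in> T"
  shows "T - {v} \<in> E" "card (T - {v}) = 2"
  using triangleD[OF assms(1,2)] assms(3) by auto

text \<open>A two-element subset of a triangle that misses \<rho> \<open>T\<close> is all of
  \<open>T - {\<rho> T}\<close>. In this form the loads are the sizes of the classes of triangles
  with a common opposite edge.\<close>

lemma opp_load_eq:
  assumes "weighted_graph n E w" "\<And>T. T \<in> triangles E \<Longrightarrow> \<rho> T \<in> T" "e \<in> E"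
  shows "opp_load E \<rho> e = card {T \<in> triangles E. T - {\<rho> T} = e}"
proof -
  have e: "card e = 2" using assms by (auto simp: weighted_graph_def)
  have "(e \<subseteq> T \<and> \<rho> T \<notin> e) = (T - {\<rho> T} = e)" if T: "T \<in> triangles E" for T
  proof
    assume "e \<subseteq> T \<and> \<rho> T \<notin> e"
    then show "T - {\<rho> T} = e"
      using opposite_edge[OF assms(1) T assms(2)[OF T]] e triangleD(2)[OF assms(1) T]
      by (intro card_subset_eq[symmetric]) auto
  qed auto
  then show ?thesis unfolding opp_load_def by (intro arg_cong[where f = card]) auto
qed

text \<open>Groups the triangles by opposite edge. With \<open>f\<close> constantly 1 it counts
  triangles; with \<open>f\<close> the greedy counters and \<rho> an optimal assignment it yields
  the cross term of the greedy analysis.\<close>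

lemma sum_opp_load_mult:
  fixes f :: "nat set \<Rightarrow> nat"
  assumes "weighted_graph n E w" "\<And>T. T \<in> triangles E \<Longrightarrow> \<rho> T \<in> T"
  shows "(\<Sum>T\<in>triangles E. f (T - {\<rho> T})) = (\<Sum>e\<in>E. opp_load E \<rho> e * f e)"
proof -
  have "(\<Sum>T\<in>triangles E. f (T - {\<rho> T})) =
      (\<Sum>e\<in>E. \<Sum>T | T \<in> triangles E \<and> T - {\<rho> T} = e. f (T - {\<rho> T}))"
    using finite_triangles[OF assms(1)] finite_edges[OF assms(1)] opposite_edge(1)[OF assms(1)] assms(2)
    by (intro sum.group[symmetric]) auto
  also have "\<dots> = (\<Sum>e\<in>E. opp_load E \<rho> e * f e)"
    by (intro sum.cong) (simp_all add: opp_load_eq[OF assms])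
  finally show ?thesis .
qed

text \<open>Uses \<open>k\<^sup>2 = k + 2 * (k choose 2)\<close>, and that each triangle loads
  exactly one edge.\<close>

lemma sum_opp_load_sq:
  assumes "weighted_graph n E w" "\<And>T. T \<in> triangles E \<Longrightarrow> \<rho> T \<in> T"
  shows "(\<Sum>e\<in>E. (opp_load E \<rho> e)\<^sup>2) = card (triangles E) + 2 * num_C4 E \<rho>"
proof -
  have sq: "k\<^sup>2 = k + 2 * (k choose 2)" for k :: nat
    by (cases k) (simp_all add: choose_two power2_eq_square)
  have "(\<Sum>e\<in>E. (opp_load E \<rho> e)\<^sup>2) = (\<Sum>e\<in>E. opp_load E \<rho> e) + 2 * num_C4 E \<rho>"
    by (subst sq) (simp add: sum.distrib num_C4_def sum_distrib_left)
  also have "(\<Sum>e\<in>E. opp_load E \<rho> e) = card (triangles E)"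
    using sum_opp_load_mult[OF assms, of "\<lambda>_. 1"] by simp
  finally show ?thesis .
qed

section \<open>Greedy loads against the optimum\<close>

lemma greedy_assignment_in:
  assumes "weighted_graph n E w" "greedy_assignment E \<rho>" "T \<in> triangles E"
  shows "\<rho> T \<in> T"
proof -
  obtain Ts l where Ts: "distinct Ts" "set Ts = triangles E" "greedy_run Ts l \<rho>"
    using assms(2) by (auto simp: greedy_assignment_def)
  \<comment> \<open>\<open>greedy_run_potential\<close> asks for a chosen edge in each triangle; the
    one opposite the largest vertex is a concrete choice.\<close>
  have "T - {Max T} \<subseteq> T \<and> card (T - {Max T}) = 2" if "T \<in> set Ts" for T
  proof -
    have T: "T \<in> triangles E" using that Ts(2) by simp
    then have "Max T \<in> T" using triangleD(1,2)[OF assms(1) T] by (intro Max_in) auto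
    then show ?thesis using opposite_edge(2)[OF assms(1) T] by blast
  qed
  moreover have "card T = 3" if "T \<in> set Ts" for T
    using triangleD(1)[OF assms(1)] that Ts(2) by simp
  ultimately have "\<forall>T\<in>set Ts. \<rho> T \<in> T"
    using greedy_run_potential[OF Ts(3,1) _ finite.emptyI, of "\<lambda>T. T - {Max T}"] by blast
  then show ?thesis using Ts(2) assms(3) by simp
qed

lemma greedy_opp_load_sq:
  assumes G: "weighted_graph n E w" and "greedy_assignment E \<rho>"
  shows "(\<Sum>e\<in>E. (opp_load E \<rho> e)\<^sup>2) \<le> 6 * card (triangles E) + 8 * C4_opt E"
proof -
  let ?D = "triangles E"
  note fin = finite_triangles[OF G] finite_edges[OF G]
  note rho = greedy_assignment_in[OF assms]
  obtain Ts l where Ts: "distinct Ts" "set Ts = ?D" "greedy_run Ts l \<rho>"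
    using assms(2) by (auto simp: greedy_assignment_def)
  have "C4_opt E \<in> num_C4 E ` (\<Pi>\<^sub>E T\<in>?D. T)"
    unfolding C4_opt_def
  proof (rule Min_in)
    show "finite (num_C4 E ` (\<Pi>\<^sub>E T\<in>?D. T))"
      using fin triangleD(2)[OF G] by (intro finite_imageI finite_PiE) auto
    \<comment> \<open>The optimum ranges over extensional functions, hence the restriction.\<close>
    have "restrict \<rho> ?D \<in> (\<Pi>\<^sub>E T\<in>?D. T)" using rho by auto
    then show "num_C4 E ` (\<Pi>\<^sub>E T\<in>?D. T) \<noteq> {}" by blast
  qed
  then obtain \<sigma> where \<sigma>: "\<And>T. T \<in> ?D \<Longrightarrow> \<sigma> T \<in> T" "C4_opt E = num_C4 E \<sigma>"
    by (auto simp: PiE_iff)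
  let ?l = "opp_load E \<rho>" and ?o = "opp_load E \<sigma>"
  define L where "L = (\<Sum>e\<in>E. (?l e)\<^sup>2)"
  have "T - {\<sigma> T} \<subseteq> T \<and> card (T - {\<sigma> T}) = 2" "card T = 3" if "T \<in> set Ts" for T
    using opposite_edge(2)[OF G _ \<sigma>(1)] triangleD(1)[OF G] that Ts(2) by auto
  then have run: "l = (\<lambda>e. card {T \<in> ?D. T - {\<rho> T} = e})"
    "(\<Sum>e\<in>E. (l e)\<^sup>2) \<le> (\<Sum>T\<in>?D. 2 * l (T - {\<sigma> T}) + 1)"
    using greedy_run_potential[OF Ts(3,1) _ fin(2), of "\<lambda>T. T - {\<sigma> T}"] Ts(2) by auto
  have l: "l e = ?l e" if "e \<in> E" for e
    unfolding run(1) using opp_load_eq[OF G rho that] by simp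
  note run(2)
  also have "(\<Sum>e\<in>E. (l e)\<^sup>2) = L"
    unfolding L_def by (intro sum.cong) (simp_all add: l)
  also have "(\<Sum>T\<in>?D. 2 * l (T - {\<sigma> T}) + 1) = 2 * (\<Sum>T\<in>?D. l (T - {\<sigma> T})) + card ?D"
    by (simp only: sum.distrib sum_distrib_left card_eq_sum)
  also have "(\<Sum>T\<in>?D. l (T - {\<sigma> T})) = (\<Sum>e\<in>E. ?o e * l e)"
    by (rule sum_opp_load_mult[OF G \<sigma>(1)])
  also have "\<dots> = (\<Sum>e\<in>E. ?o e * ?l e)"
    by (intro sum.cong) (simp_all add: l)
  finally have 1: "L \<le> 2 * (\<Sum>e\<in>E. ?o e * ?l e) + card ?D" .
  \<comment> \<open>The weights make the cross term \<open>2 * S\<close> cost only half of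
    \<open>L\<close>, which the left side can absorb. The square is expanded over the integers
    because subtraction on naturals truncates.\<close>
  have "4 * (a * b) \<le> b\<^sup>2 + 4 * a\<^sup>2" for a b :: nat
  proof -
    have "0 \<le> (int b - 2 * int a)\<^sup>2" by simp
    then have "int (4 * (a * b)) \<le> int (b\<^sup>2 + 4 * a\<^sup>2)"
      by (simp add: power2_eq_square algebra_simps)
    then show ?thesis by linarith
  qed
  then have "(\<Sum>e\<in>E. 4 * (?o e * ?l e)) \<le> (\<Sum>e\<in>E. (?l e)\<^sup>2 + 4 * (?o e)\<^sup>2)"
    by (intro sum_mono)
  also have "\<dots> = L + 4 * (\<Sum>e\<in>E. (?o e)\<^sup>2)"
    by (simp add: L_def sum.distrib sum_distrib_left)
  also have "(\<Sum>e\<in>E. (?o e)\<^sup>2) = card ?D + 2 * num_C4 E \<sigma>"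
    by (rule sum_opp_load_sq[OF G \<sigma>(1)])
  finally have "4 * (\<Sum>e\<in>E. ?o e * ?l e) \<le> L + 4 * (card ?D + 2 * num_C4 E \<sigma>)"
    by (simp add: sum_distrib_left)
  moreover define S where "S = (\<Sum>e\<in>E. ?o e * ?l e)"
  ultimately have "4 * S \<le> L + 4 * (card ?D + 2 * C4_opt E)" "L \<le> 2 * S + card ?D"
    using 1 \<sigma>(2) by simp_all
  \<comment> \<open>Twice the second inequality plus the first: the 6 is 2 + 4, and the 8 is 4 times
    the 2 in front of \<open>C4_opt E\<close>.\<close>
  then have "2 * L \<le> L + (6 * card ?D + 8 * C4_opt E)" by simp
  then show ?thesis unfolding L_def[symmetric] by simp
qed

section \<open>Local functions and their sensitivity\<close>

text \<open>For an edge \<open>e\<close>, the index of the only noise value that enters the noisy weight of \<open>e\<close>.\<close>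

definition edge_pair :: "nat set \<Rightarrow> nat \<times> nat" where
  "edge_pair e = (Min e, Max e)"

lemma card_3_distinct:
  assumes "card {v, u, x} = 3"
  shows "v \<noteq> u" "v \<noteq> x" "u \<noteq> x"
  using assms by (auto simp: card_insert_if split: if_splits)

lemma triangle_edges:
  assumes "{v, u, x} \<in> triangles E"
  shows "{v, u} \<in> E" "{v, x} \<in> E" "{u, x} \<in> E"
proof -
  have "card {v, u, x} = 3" using assms by (simp add: triangles_def)
  from card_3_distinct[OF this] assms show "{v, u} \<in> E" "{v, x} \<in> E" "{u, x} \<in> E"
    by (auto simp: triangles_def)
qed

text \<open>\<open>triangle_weight\<close> sums over increasing pairs, so the three positions of
  \<open>v\<close> relative to \<open>u < x\<close> are treated separately; symmetry of
  \<open>w\<close> turns the edges at \<open>v\<close> around.\<close>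

lemma triangle_weight_eq:
  assumes "weighted_graph n E w" "{v, u, x} \<in> triangles E" "u < x"
  shows "triangle_weight w {v, u, x} = w v u + w v x + w u x"
proof -
  have "card {v, u, x} = 3" using assms(2) by (simp add: triangles_def)
  note d = card_3_distinct[OF this]
  have sym: "w v u = w u v" "w v x = w x v"
    using assms(1) triangle_edges[OF assms(2)] by (auto simp: weighted_graph_def)
  consider "v < u" | "u < v" "v < x" | "x < v" using d by linarith
  then show ?thesis
  proof cases
    case 1
    then have "{(a, b). a \<in> {v, u, x} \<and> b \<in> {v, u, x} \<and> a < b} = {(v, u), (v, x), (u, x)}"
      using assms(3) by auto
    then show ?thesis using d unfolding triangle_weight_def by simp
  next
    case 2
    then have "{(a, b). a \<in> {v, u, x} \<and> b \<in> {v, u, x} \<and> a < b} = {(u, v), (v, x), (u, x)}"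
      using assms(3) by auto
    then show ?thesis using d sym unfolding triangle_weight_def by simp
  next
    case 3
    then have "{(a, b). a \<in> {v, u, x} \<and> b \<in> {v, u, x} \<and> a < b} = {(u, v), (x, v), (u, x)}"
      using assms(3) by auto
    then show ?thesis using d sym unfolding triangle_weight_def by simp
  qed
qed

text \<open>The index set of the sum in \<open>local_fun\<close>.\<close>

abbreviation assigned_pairs :: "nat set set \<Rightarrow> (nat set \<Rightarrow> nat) \<Rightarrow> nat \<Rightarrow> (nat \<times> nat) set" where
  "assigned_pairs E \<rho> v \<equiv> {(u, x). u < x \<and> {v, u, x} \<in> triangles E \<and> \<rho> {v, u, x} = v}"

lemma assigned_pairs_subset:
  "assigned_pairs E \<rho> v \<subseteq> nbhd E v \<times> nbhd E v"
  using triangle_edges by (auto simp: nbhd_def)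

lemma nbhd_subset:
  assumes "weighted_graph n E w"
  shows "nbhd E v \<subseteq> {1..n}"
proof
  fix u assume "u \<in> nbhd E v"
  then have "{v, u} \<in> E" by (simp add: nbhd_def)
  then have "{v, u} \<subseteq> {1..n}" using assms unfolding weighted_graph_def by blast
  then show "u \<in> {1..n}" by simp
qed

lemma finite_nbhd: "weighted_graph n E w \<Longrightarrow> finite (nbhd E v)"
  by (rule finite_subset[OF nbhd_subset]) auto

lemma finite_assigned_pairs: "weighted_graph n E w \<Longrightarrow> finite (assigned_pairs E \<rho> v)"
  by (rule finite_subset[OF assigned_pairs_subset]) (simp add: finite_nbhd)

text \<open>A triangle can be rebuilt from its assigned vertex and the ordered endpoints of the
  opposite edge; this is one direction of the bijection in \<open>sum_local_fun\<close>.\<close>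

lemma opp_edge_props:
  assumes "weighted_graph n E w" "T \<in> triangles E" "v \<in> T" "edge_pair (T - {v}) = (u, x)"
  shows "T = {v, u, x}" "u < x" "T - {v} = {u, x}" "{u, x} \<in> E"
proof -
  obtain a b where ab: "T - {v} = {a, b}" "a \<noteq> b"
    using opposite_edge(2)[OF assms(1-3)] by (auto simp: card_2_iff)
  then have ux: "u = min a b" "x = max a b"
    using assms(4) by (auto simp: edge_pair_def)
  show "u < x" using ab ux by auto
  show *: "T - {v} = {u, x}" using ab ux by (auto simp: min_def max_def)
  show "T = {v, u, x}" using * assms(3) by blast
  show "{u, x} \<in> E" using * opposite_edge(1)[OF assms(1-3)] by simp
qed

text \<open>Triples \<open>(v, u, x)\<close> with \<open>u < x\<close> and \<open>v\<close> the
  assigned vertex correspond bijectively to triangles. Node \<open>v\<close> knows its own two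
  weights exactly, so the opposite edge alone brings in noise, namely
  \<open>Y (u, x)\<close>.\<close>

lemma sum_local_fun:
  assumes G: "weighted_graph n E w" and rho: "\<And>T. T \<in> triangles E \<Longrightarrow> \<rho> T \<in> T"
  shows "(\<Sum>v\<in>{1..n}. local_fun E \<rho> g (noisy_weight w Y) v (restrict (w v) (nbhd E v))) =
    (\<Sum>T\<in>triangles E. g (triangle_weight w T + Y (edge_pair (T - {\<rho> T}))))"
proof -
  have "(\<Sum>v\<in>{1..n}. local_fun E \<rho> g (noisy_weight w Y) v (restrict (w v) (nbhd E v))) =
      (\<Sum>v\<in>{1..n}. \<Sum>(u, x)\<in>assigned_pairs E \<rho> v. g (triangle_weight w {v, u, x} + Y (u, x)))"
    unfolding local_fun_def
  proof (intro sum.cong refl, clarify)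
    fix v u x assume ux: "u < x" "{v, u, x} \<in> triangles E"
    then have "u \<in> nbhd E v" "x \<in> nbhd E v" using triangle_edges by (auto simp: nbhd_def)
    then show "g (restrict (w v) (nbhd E v) u + restrict (w v) (nbhd E v) x + noisy_weight w Y u x) =
        g (triangle_weight w {v, u, x} + Y (u, x))"
      using ux by (simp add: triangle_weight_eq[OF G] noisy_weight_def add_ac)
  qed
  also have "\<dots> = (\<Sum>(v, u, x)\<in>Sigma {1..n} (assigned_pairs E \<rho>).
      g (triangle_weight w {v, u, x} + Y (u, x)))"
    by (intro sum.Sigma ballI finite_assigned_pairs[OF G]) simp
  also have "\<dots> = (\<Sum>T\<in>triangles E. g (triangle_weight w T + Y (edge_pair (T - {\<rho> T}))))"
  proof (rule sum.reindex_bij_witness[where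
        i = "\<lambda>T. (\<rho> T, edge_pair (T - {\<rho> T}))" and j = "\<lambda>(v, u, x). {v, u, x}"])
    fix a assume a: "a \<in> Sigma {1..n} (assigned_pairs E \<rho>)"
    obtain v u x where [simp]: "a = (v, u, x)" by (cases a)
    have ux: "u < x" "{v, u, x} \<in> triangles E" "\<rho> {v, u, x} = v" using a by auto
    then have "card {v, u, x} = 3" by (simp add: triangles_def)
    then have "{v, u, x} - {v} = {u, x}" by (auto dest: card_3_distinct)
    with ux have *: "edge_pair ({v, u, x} - {\<rho> {v, u, x}}) = (u, x)" by (simp add: edge_pair_def)
    show "(\<lambda>T. (\<rho> T, edge_pair (T - {\<rho> T}))) ((\<lambda>(v, u, x). {v, u, x}) a) = a" using * ux by simp
    show "(\<lambda>(v, u, x). {v, u, x}) a \<in> triangles E" using ux by simp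
    show "g (triangle_weight w ((\<lambda>(v, u, x). {v, u, x}) a) +
        Y (edge_pair (((\<lambda>(v, u, x). {v, u, x}) a) - {\<rho> ((\<lambda>(v, u, x). {v, u, x}) a)}))) =
        (\<lambda>(v, u, x). g (triangle_weight w {v, u, x} + Y (u, x))) a" using * by simp
  next
    fix T assume T: "T \<in> triangles E"
    obtain u x where ux: "edge_pair (T - {\<rho> T}) = (u, x)" by (cases "edge_pair (T - {\<rho> T})")
    note p = opp_edge_props[OF G T rho[OF T] ux]
    show "(\<lambda>(v, u, x). {v, u, x}) (\<rho> T, edge_pair (T - {\<rho> T})) = T" using p(1) ux by simp
    have "\<rho> T \<in> {1..n}" using rho[OF T] triangleD(3)[OF G T] by blast
    then show "(\<rho> T, edge_pair (T - {\<rho> T})) \<in> Sigma {1..n} (assigned_pairs E \<rho>)"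
      using p(1,2) T ux by simp
  qed
  finally show ?thesis .
qed

section \<open>Sensitivity of the local functions\<close>

lemma local_fun_diff_le:
  assumes G: "weighted_graph n E w" and K: "\<And>k k'. \<bar>g k - g k'\<bar> \<le> K"
    and ab: "(\<Sum>i\<in>nbhd E v. \<bar>a i - b i\<bar>) \<le> (1::int)"
  shows "\<bar>local_fun E \<rho> g w' v a - local_fun E \<rho> g w' v b\<bar> \<le> K * real (card (nbhd E v))"
proof -
  let ?N = "nbhd E v" and ?P = "assigned_pairs E \<rho> v"
  note fin = finite_nbhd[OF G] finite_assigned_pairs[OF G]
  have K0: "0 \<le> K" using K[of 0 0] by simp
  \<comment> \<open>Integer vectors at \<ell>1 distance at most one differ in at most one
    coordinate; \<open>i\<close> is that coordinate, or arbitrary if there is none.\<close>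
  obtain i where i: "\<And>j. j \<in> ?N \<Longrightarrow> j \<noteq> i \<Longrightarrow> a j = b j"
  proof (cases "\<exists>i\<in>?N. a i \<noteq> b i")
    case True
    then obtain i where i: "i \<in> ?N" "a i \<noteq> b i" by blast
    have "\<bar>a i - b i\<bar> + (\<Sum>j\<in>?N - {i}. \<bar>a j - b j\<bar>) \<le> 1"
      using ab i fin(1) by (simp add: sum.remove)
    with i have "(\<Sum>j\<in>?N - {i}. \<bar>a j - b j\<bar>) \<le> 0" by linarith
    moreover have "(\<Sum>j\<in>?N - {i}. \<bar>a j - b j\<bar>) \<ge> 0" by (intro sum_nonneg) auto
    ultimately have "\<forall>j\<in>?N - {i}. \<bar>a j - b j\<bar> = 0"
      using fin(1) by (subst sum_nonneg_eq_0_iff[symmetric]) auto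
    then show thesis by (intro that[of i]) auto
  next
    case False
    then show thesis using that by blast
  qed
  let ?Q = "{p \<in> ?P. fst p = i \<or> snd p = i}"
  have "\<bar>local_fun E \<rho> g w' v a - local_fun E \<rho> g w' v b\<bar> =
      \<bar>\<Sum>(u, x)\<in>?P. g (a u + a x + w' u x) - g (b u + b x + w' u x)\<bar>"
    unfolding local_fun_def by (simp add: sum_subtractf split_def)
  also have "\<dots> \<le> (\<Sum>(u, x)\<in>?P. \<bar>g (a u + a x + w' u x) - g (b u + b x + w' u x)\<bar>)"
    using sum_abs[of "\<lambda>(u, x). g (a u + a x + w' u x) - g (b u + b x + w' u x)" ?P]
    by (simp add: split_def)
  also have "\<dots> \<le> (\<Sum>p\<in>?P. if fst p = i \<or> snd p = i then K else 0)"
  proof (intro sum_mono, clarify)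
    fix u x assume ux: "u < x" "{v, u, x} \<in> triangles E"
    then have "u \<in> ?N" "x \<in> ?N" using triangle_edges by (auto simp: nbhd_def)
    then show "\<bar>g (a u + a x + w' u x) - g (b u + b x + w' u x)\<bar> \<le>
        (if fst (u, x) = i \<or> snd (u, x) = i then K else 0)"
      using K i by auto
  qed
  also have "\<dots> = K * real (card ?Q)"
    using fin(2) by (simp add: sum.If_cases Int_def)
  \<comment> \<open>A pair containing \<open>i\<close> is determined by its other entry. The order
    \<open>u < x\<close> keeps \<open>(i, x)\<close> and \<open>(u, i)\<close> from having the same
    other entry.\<close>
  also have "card ?Q \<le> card ?N"
  proof (rule card_inj_on_le[where f = "\<lambda>(u, x). if u = i then x else u"])
    show "inj_on (\<lambda>(u, x). if u = i then x else u) ?Q"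
      by (auto simp: inj_on_def split: if_splits)
    show "(\<lambda>(u, x). if u = i then x else u) ` ?Q \<subseteq> ?N"
      using assigned_pairs_subset[where E = E and \<rho> = \<rho> and v = v] by auto
  qed (rule fin(1))
  finally show ?thesis using K0 by (simp add: mult_left_mono)
qed

text \<open>\<open>GS\<close> is a \<open>Max\<close>, so the set of differences must first be shown
  finite and nonempty; then the maximum is one of the differences bounded above.\<close>

lemma GS_local_fun:
  assumes G: "weighted_graph n E w" and g: "finite (range g)" and K: "\<And>k k'. \<bar>g k - g k'\<bar> \<le> K"
  shows "0 \<le> GS (nbhd E v) (local_fun E \<rho> g w' v)"
    and "GS (nbhd E v) (local_fun E \<rho> g w' v) \<le> K * real (card (nbhd E v))"
proof -
  let ?F = "local_fun E \<rho> g w' v" and ?P = "assigned_pairs E \<rho> v" and ?N = "nbhd E v"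
  let ?S = "{\<bar>?F a - ?F b\<bar> | a b. a \<in> (\<Pi>\<^sub>E i\<in>?N. UNIV) \<and> b \<in> (\<Pi>\<^sub>E i\<in>?N. UNIV) \<and>
    (\<Sum>i\<in>?N. \<bar>a i - b i\<bar>) \<le> 1}"
  \<comment> \<open>Each value is the sum of one of the finitely many functions from the assigned
    pairs into \<open>range g\<close>.\<close>
  have "range ?F \<subseteq> (\<lambda>t. sum t ?P) ` (\<Pi>\<^sub>E p\<in>?P. range g)"
  proof clarify
    fix a
    let ?t = "restrict (\<lambda>(u, x). g (a u + a x + w' u x)) ?P"
    have "?F a = sum ?t ?P" unfolding local_fun_def by (intro sum.cong) auto
    moreover have "?t \<in> (\<Pi>\<^sub>E p\<in>?P. range g)" by auto
    ultimately show "?F a \<in> (\<lambda>t. sum t ?P) ` (\<Pi>\<^sub>E p\<in>?P. range g)" by blast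
  qed
  then have F: "finite (range ?F)"
    by (rule finite_subset) (intro finite_imageI finite_PiE finite_assigned_pairs[OF G] g)
  have fin: "finite ?S"
    by (rule finite_subset[of _ "(\<lambda>(s, t). \<bar>s - t\<bar>) ` (range ?F \<times> range ?F)"]) (use F in auto)
  let ?z = "restrict (\<lambda>_. 0::int) ?N"
  have "\<bar>?F ?z - ?F ?z\<bar> \<in> ?S" by (intro CollectI exI[of _ ?z]) auto
  then have 0: "0 \<in> ?S" by simp
  show "0 \<le> GS ?N ?F" unfolding GS_def by (rule Max_ge[OF fin 0])
  have "Max ?S \<in> ?S" using fin 0 by (intro Max_in) auto
  then show "GS ?N ?F \<le> K * real (card ?N)"
    unfolding GS_def using local_fun_diff_le[OF G K] by auto
qed

section \<open>Degree sums\<close>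

lemma sum_degree:
  assumes G: "weighted_graph n E w"
  shows "(\<Sum>v\<in>{1..n}. card (nbhd E v)) = 2 * card E"
proof -
  have "card (nbhd E v) = card {e \<in> E. v \<in> e}" for v
  proof (rule bij_betw_same_card[of "\<lambda>u. {v, u}"])
    show "bij_betw (\<lambda>u. {v, u}) (nbhd E v) {e \<in> E. v \<in> e}"
      unfolding bij_betw_def
    proof
      show "inj_on (\<lambda>u. {v, u}) (nbhd E v)" by (auto simp: inj_on_def doubleton_eq_iff)
      show "(\<lambda>u. {v, u}) ` nbhd E v = {e \<in> E. v \<in> e}"
      proof safe
        fix e assume e: "e \<in> E" "v \<in> e"
        then have "card e = 2" using G by (simp add: weighted_graph_def)
        then obtain u where "e = {v, u}" using e(2) by (auto simp: card_2_iff)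
        then show "e \<in> (\<lambda>u. {v, u}) ` nbhd E v" using e(1) by (auto simp: nbhd_def)
      qed (auto simp: nbhd_def)
    qed
  qed
  then have "(\<Sum>v\<in>{1..n}. card (nbhd E v)) = (\<Sum>v\<in>{1..n}. card {e \<in> E. v \<in> e})" by simp
  \<comment> \<open>Double counting of incident vertex-edge pairs.\<close>
  also have "\<dots> = 2 * card E"
  proof (rule sum_multicount)
    show "\<forall>e\<in>E. card {v \<in> {1..n}. v \<in> e} = 2"
    proof
      fix e assume e: "e \<in> E"
      then have "e \<subseteq> {1..n}" using G by (simp add: weighted_graph_def)
      then have "{v \<in> {1..n}. v \<in> e} = e" by blast
      then show "card {v \<in> {1..n}. v \<in> e} = 2" using G e by (simp add: weighted_graph_def)
    qed
  qed (use finite_edges[OF G] in auto)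
  finally show ?thesis .
qed

lemma sum_degree_sq_le:
  assumes G: "weighted_graph n E w"
  shows "(\<Sum>v\<in>{1..n}. (card (nbhd E v))\<^sup>2) \<le> 2 * max_degree n E * card E"
proof -
  have "(\<Sum>v\<in>{1..n}. (card (nbhd E v))\<^sup>2) \<le> (\<Sum>v\<in>{1..n}. max_degree n E * card (nbhd E v))"
    by (intro sum_mono) (auto simp: power2_eq_square max_degree_def)
  also have "\<dots> = max_degree n E * (2 * card E)"
    using sum_degree[OF G] by (simp add: sum_distrib_left[symmetric])
  finally show ?thesis by (simp add: mult_ac)
qed

section \<open>Noise moments\<close>

lemma sets_Lap [measurable_cong, simp]: "sets (Lap b) = sets borel"
  by (simp add: Lap_def)

lemma space_Lap [simp]: "space (Lap b) = UNIV"
  by (simp add: Lap_def)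

text \<open>Folding the density onto the positive half-line pairs \<open>c + y\<close> with
  \<open>c - y\<close>, so the term linear in \<open>y\<close> cancels and the exponential moments
  of order 0 and 2 remain. For \<open>b = 0\<close> the measure is a point mass at 0.\<close>

lemma nn_integral_Lap_sq:
  assumes "0 \<le> b"
  shows "(\<integral>\<^sup>+y. ennreal ((c + y)\<^sup>2) \<partial>Lap b) = ennreal (c\<^sup>2 + 2 * b\<^sup>2)"
proof (cases "b = 0")
  case True
  then show ?thesis by (simp add: Lap_def nn_integral_return)
next
  case False
  with assms have b: "b > 0" by simp
  let ?d = "exponential_density (1 / b)"
  have dpos: "0 \<le> ?d y" for y using b by (simp add: exponential_density_def)
  have "(\<integral>\<^sup>+y. ennreal ((c + y)\<^sup>2) \<partial>Lap b) =
      (\<integral>\<^sup>+y. ennreal (1 / (2 * b) * exp (- \<bar>y\<bar> / b)) * ennreal ((c + y)\<^sup>2) \<partial>lborel)"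
    using b by (simp add: Lap_def nn_integral_density)
  \<comment> \<open>The Laplace density is the symmetrized exponential density.\<close>
  also have "\<dots> = (\<integral>\<^sup>+y. ennreal (1 / 2 * ?d y * (c + y)\<^sup>2) + ennreal (1 / 2 * ?d (- y) * (c + y)\<^sup>2) \<partial>lborel)"
  proof (rule nn_integral_cong_AE)
    \<comment> \<open>At \<open>y = 0\<close> both exponential halves are positive and would count
      twice; that point is a null set.\<close>
    show "AE y in lborel. ennreal (1 / (2 * b) * exp (- \<bar>y\<bar> / b)) * ennreal ((c + y)\<^sup>2) =
        ennreal (1 / 2 * ?d y * (c + y)\<^sup>2) + ennreal (1 / 2 * ?d (- y) * (c + y)\<^sup>2)"
      using AE_lborel_singleton[of 0]
    proof eventually_elim
      case (elim y)
      then show ?case using b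
        by (cases "y < 0") (simp_all add: exponential_density_def ennreal_mult' [symmetric])
    qed
  qed
  also have "\<dots> = (\<integral>\<^sup>+y. ennreal (1 / 2 * ?d y * (c + y)\<^sup>2) \<partial>lborel) +
      (\<integral>\<^sup>+y. ennreal (1 / 2 * ?d (- y) * (c + y)\<^sup>2) \<partial>lborel)"
    by (rule nn_integral_add) auto
  also have "(\<integral>\<^sup>+y. ennreal (1 / 2 * ?d (- y) * (c + y)\<^sup>2) \<partial>lborel) =
      (\<integral>\<^sup>+y. ennreal (1 / 2 * ?d y * (c - y)\<^sup>2) \<partial>lborel)"
    using nn_integral_real_affine[of "\<lambda>y. ennreal (1 / 2 * ?d y * (c - y)\<^sup>2)" "-1" 0] by simp
  also have "(\<integral>\<^sup>+y. ennreal (1 / 2 * ?d y * (c + y)\<^sup>2) \<partial>lborel) + \<dots> =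
      (\<integral>\<^sup>+y. ennreal (1 / 2 * ?d y * (c + y)\<^sup>2) + ennreal (1 / 2 * ?d y * (c - y)\<^sup>2) \<partial>lborel)"
    by (rule nn_integral_add[symmetric]) auto
  \<comment> \<open>The factor \<open>y ^ 0\<close> is kept to match the form of the Erlang moment
    formula.\<close>
  also have "\<dots> = (\<integral>\<^sup>+y. ennreal (c\<^sup>2) * ennreal (?d y * y ^ 0) + ennreal (?d y * y ^ 2) \<partial>lborel)"
  proof (intro nn_integral_cong)
    fix y :: real
    have "ennreal (1 / 2 * ?d y * (c + y)\<^sup>2) + ennreal (1 / 2 * ?d y * (c - y)\<^sup>2) =
        ennreal (1 / 2 * ?d y * (c + y)\<^sup>2 + 1 / 2 * ?d y * (c - y)\<^sup>2)"
      using dpos[of y] by (intro ennreal_plus[symmetric]) auto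
    also have "1 / 2 * ?d y * (c + y)\<^sup>2 + 1 / 2 * ?d y * (c - y)\<^sup>2 = c\<^sup>2 * (?d y * y ^ 0) + ?d y * y\<^sup>2"
      by (simp add: power2_eq_square field_simps)
    also have "ennreal (c\<^sup>2 * (?d y * y ^ 0) + ?d y * y\<^sup>2) =
        ennreal (c\<^sup>2) * ennreal (?d y * y ^ 0) + ennreal (?d y * y\<^sup>2)"
      using dpos[of y] by (simp add: ennreal_mult')
    finally show "ennreal (1 / 2 * ?d y * (c + y)\<^sup>2) + ennreal (1 / 2 * ?d y * (c - y)\<^sup>2) =
        ennreal (c\<^sup>2) * ennreal (?d y * y ^ 0) + ennreal (?d y * y ^ 2)" .
  qed
  also have "\<dots> = ennreal (c\<^sup>2) * (\<integral>\<^sup>+y. ennreal (?d y * y ^ 0) \<partial>lborel) + (\<integral>\<^sup>+y. ennreal (?d y * y ^ 2) \<partial>lborel)"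
    by (subst nn_integral_add) (simp_all add: nn_integral_cmult)
  also have "\<dots> = ennreal (c\<^sup>2) * ennreal 1 + ennreal (2 * b\<^sup>2)"
    using nn_integral_erlang_ith_moment[of "1 / b" 0 0] nn_integral_erlang_ith_moment[of "1 / b" 0 2] b
    by (simp add: power_divide fact_2)
  finally show ?thesis by (simp flip: ennreal_plus)
qed

text \<open>Induction with \<open>c\<close> generalised: when the new coordinate is integrated out
  first, the sum of the others joins the constant.\<close>

lemma nn_integral_PiM_Lap_sq:
  assumes "finite I" and b: "\<And>i. 0 \<le> b i"
  shows "(\<integral>\<^sup>+L. ennreal ((c + (\<Sum>i\<in>I. L i))\<^sup>2) \<partial>(\<Pi>\<^sub>M i\<in>I. Lap (b i))) =
    ennreal (c\<^sup>2 + (\<Sum>i\<in>I. 2 * (b i)\<^sup>2))"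
  using assms(1)
proof (induction I arbitrary: c)
  case empty
  interpret product_prob_space "\<lambda>i. Lap (b i)"
    by (intro product_prob_spaceI prob_space_Lap b)
  show ?case by (simp add: PiM_empty nn_integral_count_space_finite)
next
  case (insert i I)
  interpret product_prob_space "\<lambda>i. Lap (b i)"
    by (intro product_prob_spaceI prob_space_Lap b)
  interpret I: prob_space "\<Pi>\<^sub>M i\<in>I. Lap (b i)"
    by (intro prob_space_PiM prob_space_Lap b)
  have "(\<integral>\<^sup>+L. ennreal ((c + (\<Sum>i\<in>insert i I. L i))\<^sup>2) \<partial>(\<Pi>\<^sub>M i\<in>insert i I. Lap (b i))) =
     (\<integral>\<^sup>+L. (\<integral>\<^sup>+y. ennreal ((c + (\<Sum>j\<in>insert i I. (L(i := y)) j))\<^sup>2) \<partial>Lap (b i)) \<partial>(\<Pi>\<^sub>M i\<in>I. Lap (b i)))"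
    using insert by (intro product_nn_integral_insert) auto
  also have "\<dots> = (\<integral>\<^sup>+L. (\<integral>\<^sup>+y. ennreal (((c + (\<Sum>j\<in>I. L j)) + y)\<^sup>2) \<partial>Lap (b i)) \<partial>(\<Pi>\<^sub>M i\<in>I. Lap (b i)))"
  proof (intro nn_integral_cong)
    fix L and y :: real
    have "(\<Sum>j\<in>insert i I. (L(i := y)) j) = y + (\<Sum>j\<in>I. L j)"
      using insert by (auto intro!: sum.cong)
    then show "ennreal ((c + (\<Sum>j\<in>insert i I. (L(i := y)) j))\<^sup>2) = ennreal (((c + (\<Sum>j\<in>I. L j)) + y)\<^sup>2)"
      by (simp add: add_ac)
  qed
  also have "\<dots> = (\<integral>\<^sup>+L. ennreal ((c + (\<Sum>j\<in>I. L j))\<^sup>2) + ennreal (2 * (b i)\<^sup>2) \<partial>(\<Pi>\<^sub>M i\<in>I. Lap (b i)))"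
    by (simp add: nn_integral_Lap_sq b)
  also have "\<dots> = ennreal (c\<^sup>2 + (\<Sum>i\<in>I. 2 * (b i)\<^sup>2)) + ennreal (2 * (b i)\<^sup>2)"
    by (subst nn_integral_add) (simp_all add: insert.IH I.emeasure_space_1)
  also have "\<dots> = ennreal (c\<^sup>2 + (\<Sum>i\<in>insert i I. 2 * (b i)\<^sup>2))"
    using insert by (subst ennreal_plus[symmetric]) (auto intro!: sum_nonneg add_nonneg_nonneg simp: algebra_simps)
  finally show ?case .
qed

section \<open>Expectations under product distributions\<close>

lemma pmf_nn_integral_bounded:
  fixes f :: "'a \<Rightarrow> real"
  assumes "\<And>x. 0 \<le> f x" "\<And>x. f x \<le> B"
  shows "(\<integral>\<^sup>+x. ennreal (f x) \<partial>measure_pmf p) = ennreal (measure_pmf.expectation p f)"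
  using assms by (intro nn_integral_eq_integral measure_pmf.integrable_const_bound[where B = B]) auto

lemma expectation_Pi_pmf_component:
  fixes f :: "'b \<Rightarrow> real"
  assumes "finite A" "x \<in> A"
  shows "measure_pmf.expectation (Pi_pmf A dflt p) (\<lambda>Y. f (Y x)) = measure_pmf.expectation (p x) f"
proof -
  have "p x = map_pmf (\<lambda>Y. Y x) (Pi_pmf A dflt p)"
    using assms by (simp add: Pi_pmf_component)
  then show ?thesis by simp
qed

lemma expectation_Pi_pmf_mult:
  fixes F G :: "'b \<Rightarrow> real"
  assumes "finite A" "x \<in> A" "y \<in> A" "x \<noteq> y"
    and F: "\<And>k. \<bar>F k\<bar> \<le> B" and G: "\<And>k. \<bar>G k\<bar> \<le> C"
  shows "measure_pmf.expectation (Pi_pmf A dflt p) (\<lambda>Y. F (Y x) * G (Y y)) =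
    measure_pmf.expectation (p x) F * measure_pmf.expectation (p y) G"
proof -
  \<comment> \<open>\<open>?H\<close> packs both functions into one family indexed by coordinates,
    the shape in which independence is available.\<close>
  let ?P = "Pi_pmf A dflt p" and ?H = "\<lambda>z. if z = x then F else G"
  have int: "integrable (measure_pmf ?P) (\<lambda>Y. F (Y x))" "integrable (measure_pmf ?P) (\<lambda>Y. G (Y y))"
    using F G by (intro measure_pmf.integrable_const_bound[where B = B] measure_pmf.integrable_const_bound[where B = C]; simp)+
  note P = measure_pmf.prob_space_axioms[of ?P]
  have "prob_space.indep_vars ?P (\<lambda>_. borel) (\<lambda>z Y. ?H z (Y z)) {x, y}"
    by (rule prob_space.indep_vars_compose2[OF P
          prob_space.indep_vars_subset[OF P indep_vars_Pi_pmf[OF assms(1)]]]) (use assms in auto)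
  then have "(\<integral>Y. (\<Prod>z\<in>{x, y}. ?H z (Y z)) \<partial>?P) = (\<Prod>z\<in>{x, y}. \<integral>Y. ?H z (Y z) \<partial>?P)"
    using int by (intro prob_space.indep_vars_lebesgue_integral[OF P]) auto
  then show ?thesis using assms by (auto simp: expectation_Pi_pmf_component)
qed

text \<open>Expanding the square, the mixed terms vanish: injectivity of \<open>d\<close> makes
  their coordinates distinct, hence independent, and each factor has mean zero. The bound
  \<open>B\<close> gives integrability.\<close>

lemma expectation_Pi_pmf_sum_sq:
  fixes F :: "'i \<Rightarrow> 'b \<Rightarrow> real"
  assumes A: "finite A" and I: "finite I" "inj_on d I" "d ` I \<subseteq> A"
    and bnd: "\<And>i k. i \<in> I \<Longrightarrow> \<bar>F i k\<bar> \<le> B"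
    and zero: "\<And>i. i \<in> I \<Longrightarrow> measure_pmf.expectation (p (d i)) (F i) = 0"
  shows "measure_pmf.expectation (Pi_pmf A dflt p) (\<lambda>Y. (\<Sum>i\<in>I. F i (Y (d i)))\<^sup>2) =
    (\<Sum>i\<in>I. measure_pmf.expectation (p (d i)) (\<lambda>k. (F i k)\<^sup>2))"
proof -
  let ?P = "Pi_pmf A dflt p"
  have int: "integrable (measure_pmf ?P) (\<lambda>Y. F i (Y (d i)) * F j (Y (d j)))" if "i \<in> I" "j \<in> I" for i j
  proof (rule measure_pmf.integrable_const_bound[where B = "B * B"])
    show "AE Y in ?P. norm (F i (Y (d i)) * F j (Y (d j))) \<le> B * B"
      unfolding real_norm_def abs_mult
      by (intro AE_I2 mult_mono bnd that) (use bnd[OF that(1)] abs_ge_zero order_trans in blast)+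
  qed simp
  have E: "measure_pmf.expectation ?P (\<lambda>Y. F i (Y (d i)) * F j (Y (d j))) =
      (if i = j then measure_pmf.expectation (p (d i)) (\<lambda>k. (F i k)\<^sup>2) else 0)" if "i \<in> I" "j \<in> I" for i j
  proof (cases "i = j")
    case True
    then show ?thesis
      using expectation_Pi_pmf_component[OF A, of "d i" dflt p "\<lambda>k. (F i k)\<^sup>2"] I that
      by (auto simp: power2_eq_square)
  next
    case False
    moreover have "d i \<noteq> d j" "d i \<in> A" "d j \<in> A"
      using False I(2,3) that by (auto simp: inj_on_def)
    ultimately show ?thesis
      using expectation_Pi_pmf_mult[OF A, of "d i" "d j" "F i" B "F j" B dflt p] bnd zero that
      by simp
  qed
  have "measure_pmf.expectation ?P (\<lambda>Y. (\<Sum>i\<in>I. F i (Y (d i)))\<^sup>2) =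
      measure_pmf.expectation ?P (\<lambda>Y. \<Sum>i\<in>I. \<Sum>j\<in>I. F i (Y (d i)) * F j (Y (d j)))"
    by (simp add: power2_eq_square sum_product)
  also have "\<dots> = (\<Sum>i\<in>I. \<Sum>j\<in>I. measure_pmf.expectation ?P (\<lambda>Y. F i (Y (d i)) * F j (Y (d j))))"
    by (simp add: int)
  also have "\<dots> = (\<Sum>i\<in>I. \<Sum>j\<in>I. if i = j then measure_pmf.expectation (p (d i)) (\<lambda>k. (F i k)\<^sup>2) else 0)"
    by (intro sum.cong refl E)
  also have "\<dots> = (\<Sum>i\<in>I. measure_pmf.expectation (p (d i)) (\<lambda>k. (F i k)\<^sup>2))"
    using I(1) by simp
  finally show ?thesis .
qed

section \<open>Discrete Laplace noise\<close>

context
  fixes p :: real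
  assumes p: "0 < p" "p < 1"
begin

text \<open>A geometric series. The map \<open>f\<close> enumerates a set of integers with absolute
  values \<open>m\<close>, \<open>m + 1\<close>, ..., so one statement serves the left and the right
  tail.\<close>

lemma prob_DLap_tail:
  assumes f: "inj f" "\<And>k. nat \<bar>f k\<bar> = m + k"
  shows "measure_pmf.prob (DLap p) (range f) = p ^ m / (1 + p)"
proof -
  let ?c = "(1 - p) / (1 + p)"
  have "(\<lambda>k. ?c * p ^ m * p ^ k) sums (?c * p ^ m * (1 / (1 - p)))"
    by (intro sums_mult geometric_sums) (use p in auto)
  also have "?c * p ^ m * (1 / (1 - p)) = p ^ m / (1 + p)" using p by (simp add: divide_simps)
  finally have s: "(\<lambda>k. pmf (DLap p) (f k)) sums (p ^ m / (1 + p))"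
    by (simp add: pmf_DLap p f(2) power_add mult_ac)
  have "emeasure (DLap p) (range f) = (\<integral>\<^sup>+k. ennreal (pmf (DLap p) (f k)) \<partial>count_space UNIV)"
    using f(1) by (simp add: nn_integral_pmf')
  also have "\<dots> = (\<Sum>k. ennreal (pmf (DLap p) (f k)))"
    by (rule nn_integral_count_space_nat)
  also have "\<dots> = ennreal (p ^ m / (1 + p))"
    using p by (intro sums_unique[symmetric] sums_ennreal[THEN iffD2] s) auto
  finally show ?thesis using p by (simp add: measure_def)
qed

lemma prob_DLap_atMost:
  "measure_pmf.prob (DLap p) {..j} =
    (if 0 \<le> j then 1 - p ^ nat (j + 1) / (1 + p) else p ^ nat (- j) / (1 + p))"
proof (cases "0 \<le> j")
  case True
  have "range (\<lambda>k. j + 1 + int k) = {j + 1..}"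
  proof safe
    fix i assume "j + 1 \<le> i"
    then have "i = j + 1 + int (nat (i - j - 1))" by simp
    then show "i \<in> range (\<lambda>k. j + 1 + int k)" by blast
  qed auto
  then have "measure_pmf.prob (DLap p) {j + 1..} = p ^ nat (j + 1) / (1 + p)"
    using prob_DLap_tail[of "\<lambda>k. j + 1 + int k" "nat (j + 1)"] True by (auto simp: inj_def)
  moreover have "{..j} = UNIV - {j + 1..}" by auto
  ultimately show ?thesis
    using True measure_pmf.prob_compl[of "{j + 1..}" "DLap p"] by simp
next
  case False
  have "range (\<lambda>k. j - int k) = {..j}"
  proof safe
    fix i assume "i \<le> j"
    then have "i = j - int (nat (j - i))" by simp
    then show "i \<in> range (\<lambda>k. j - int k)" by blast
  qed auto
  then show ?thesis
    using prob_DLap_tail[of "\<lambda>k. j - int k" "nat (- j)"] False by (auto simp: inj_def)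
qed

text \<open>Writes the estimator as a threshold indicator minus \<open>p / (1 - p)\<^sup>2\<close>
  times its discrete second difference. Since \<open>DLap p\<close> has generating function
  \<open>1 / (1 - p / (1 - p)\<^sup>2 * (z - 2 + 1 / z))\<close>, this is exactly the operator that
  inverts convolution with the noise.\<close>

lemma unbiased_est_eq:
  "unbiased_est p lam (k + y) = indicator {..lam - 1 - k} y +
    p / (1 - p)\<^sup>2 * (indicator {lam - 1 - k} y - indicator {lam - k} y)"
  unfolding unbiased_est_def by (auto simp: indicator_def)

text \<open>The distribution function at \<open>j\<close> misses the threshold value by
  \<open>p ^ (j + 1) / (1 + p)\<close> from below if \<open>j\<close> is nonnegative and by
  \<open>p ^ (- j) / (1 + p)\<close> from above otherwise; the difference of the two point masses
  compensates exactly.\<close>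

lemma expectation_unbiased_est:
  "measure_pmf.expectation (DLap p) (\<lambda>y. unbiased_est p lam (k + y)) = biased_est lam k"
proof -
  define j where "j = lam - 1 - k"
  have [simp]: "integrable (measure_pmf (DLap p)) (indicator S :: int \<Rightarrow> real)" for S
    by (rule measure_pmf.integrable_const_bound[where B = 1]) (auto simp: indicator_def)
  have "measure_pmf.expectation (DLap p) (\<lambda>y. unbiased_est p lam (k + y)) =
      measure_pmf.prob (DLap p) {..j} + p / (1 - p)\<^sup>2 * (pmf (DLap p) j - pmf (DLap p) (j + 1))"
    by (simp add: unbiased_est_eq j_def measure_pmf_single)
  also have "\<dots> = (if 0 \<le> j then 1 else 0)"
  proof (cases "0 \<le> j")
    case True
    then have "nat (j + 1) = Suc (nat j)" by simp
    then show ?thesis using True p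
      by (simp add: prob_DLap_atMost pmf_DLap divide_simps power2_eq_square)
        (simp add: algebra_simps)
  next
    case False
    then have "nat \<bar>j\<bar> = Suc (nat \<bar>j + 1\<bar>)" "nat (- j) = Suc (nat \<bar>j + 1\<bar>)" by simp_all
    then show ?thesis using False p
      by (simp add: prob_DLap_atMost pmf_DLap divide_simps power2_eq_square)
        (simp add: algebra_simps)
  qed
  finally show ?thesis by (simp add: biased_est_def j_def)
qed

text \<open>The large correction acts at two points only, each of mass at most \<open>1 - p\<close>.
  This factor lowers the order of the variance from \<open>1 / \<epsilon>\<^sub>1 ^ 4\<close> to
  \<open>1 / \<epsilon>\<^sub>1 ^ 3\<close> for small \<open>\<epsilon>\<^sub>1\<close>.\<close>

lemma expectation_unbiased_est_sq:
  "measure_pmf.expectation (DLap p) (\<lambda>y. (unbiased_est p lam (k + y) - biased_est lam k)\<^sup>2)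
    \<le> 2 + 4 * (p / (1 - p)\<^sup>2)\<^sup>2 * (1 - p)"
proof -
  let ?c = "p / (1 - p)\<^sup>2"
  define j where "j = lam - 1 - k"
  have [simp]: "integrable (measure_pmf (DLap p)) (indicator S :: int \<Rightarrow> real)" for S
    by (rule measure_pmf.integrable_const_bound[where B = 1]) (auto simp: indicator_def)
  have c: "0 \<le> ?c" using p by simp
  have pmf_le: "pmf (DLap p) i \<le> 1 - p" for i
  proof -
    have "(1 - p) / (1 + p) * p ^ nat \<bar>i\<bar> \<le> (1 - p) * 1"
      using p by (intro mult_mono) (auto simp: divide_simps power_le_one)
    then show ?thesis using p by (simp add: pmf_DLap)
  qed
  have "measure_pmf.expectation (DLap p) (\<lambda>y. (unbiased_est p lam (k + y) - biased_est lam k)\<^sup>2) \<le>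
      measure_pmf.expectation (DLap p) (\<lambda>y. 2 + 2 * ?c\<^sup>2 * (indicator {j} y + indicator {j + 1} y))"
  proof (intro integral_mono)
    show "integrable (measure_pmf (DLap p)) (\<lambda>y. (unbiased_est p lam (k + y) - biased_est lam k)\<^sup>2)"
    proof (rule measure_pmf.integrable_const_bound[where B = "(2 + ?c)\<^sup>2"])
      show "AE y in DLap p. norm ((unbiased_est p lam (k + y) - biased_est lam k)\<^sup>2) \<le> (2 + ?c)\<^sup>2"
        using c by (intro AE_I2) (auto simp: unbiased_est_def biased_est_def abs_le_square_iff[symmetric])
    qed simp
    fix y
    have sq: "(a + b)\<^sup>2 \<le> 2 * a\<^sup>2 + 2 * b\<^sup>2" for a b :: real
      using sum_squares_bound[of a b] by (simp add: power2_sum)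
    let ?a = "indicator {..j} y - biased_est lam k"
    let ?b = "?c * (indicator {j} y - indicator {j + 1} y)"
    have "(unbiased_est p lam (k + y) - biased_est lam k)\<^sup>2 = (?a + ?b)\<^sup>2"
      by (intro arg_cong[where f = "\<lambda>x. x\<^sup>2"]) (simp add: unbiased_est_eq j_def)
    also have "\<dots> \<le> 2 * ?a\<^sup>2 + 2 * ?b\<^sup>2" by (rule sq)
    \<comment> \<open>The threshold part is off by at most one, and the two point indicators are
      disjoint, so squaring their difference gives their sum.\<close>
    also have "\<dots> \<le> 2 * 1 + 2 * (?c\<^sup>2 * (indicator {j} y + indicator {j + 1} y))"
      by (intro add_mono mult_left_mono) (auto simp: indicator_def biased_est_def power_mult_distrib)
    finally show "(unbiased_est p lam (k + y) - biased_est lam k)\<^sup>2 \<le>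
        2 + 2 * ?c\<^sup>2 * (indicator {j} y + indicator {j + 1} y)" by simp
  qed auto
  also have "\<dots> = 2 + 2 * ?c\<^sup>2 * (pmf (DLap p) j + pmf (DLap p) (j + 1))"
    by (simp add: measure_pmf_single)
  also have "\<dots> \<le> 2 + 2 * ?c\<^sup>2 * ((1 - p) + (1 - p))"
    by (intro add_left_mono mult_left_mono add_mono pmf_le) auto
  finally show ?thesis by (simp add: algebra_simps)
qed

text \<open>The exact value is \<open>2 * p / (1 + p)\<close>.\<close>

lemma prob_DLap_nonzero: "measure_pmf.prob (DLap p) (- {0}) \<le> 2 * p"
proof -
  have "measure_pmf.prob (DLap p) (- {0}) = 1 - (1 - p) / (1 + p)"
    using measure_pmf.prob_compl[of "{0}" "DLap p"] p
    by (simp add: Compl_eq_Diff_UNIV measure_pmf_single pmf_DLap)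
  also have "\<dots> \<le> 2 * p" using p by (simp add: divide_simps)
  finally show ?thesis .
qed

end

section \<open>The mean squared error\<close>

text \<open>The total error before the second-step noise is added, written with one summand per
  triangle; \<open>sum_local_fun\<close> and \<open>count_below_eq\<close> justify this
  form.\<close>

definition step1_error ::
  "(int \<Rightarrow> real) \<Rightarrow> int \<Rightarrow> nat set set \<Rightarrow> (nat \<Rightarrow> nat \<Rightarrow> int) \<Rightarrow> (nat set \<Rightarrow> nat) \<Rightarrow> (nat \<times> nat \<Rightarrow> int) \<Rightarrow> real"
where
  "step1_error g lam E w \<rho> Y = (\<Sum>T\<in>triangles E.
     g (triangle_weight w T + Y (edge_pair (T - {\<rho> T}))) - biased_est lam (triangle_weight w T))"

lemma count_below_eq:
  assumes "weighted_graph n E w"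
  shows "real (count_below E w lam) = (\<Sum>T\<in>triangles E. biased_est lam (triangle_weight w T))"
  using finite_triangles[OF assms]
  by (simp add: count_below_def biased_est_def sum.If_cases Int_def)

lemma finite_range_bounded:
  fixes g :: "'a \<Rightarrow> real"
  assumes "finite (range g)"
  obtains B where "\<And>k. \<bar>g k\<bar> \<le> B"
  using finite_imp_bounded[OF assms] by (auto simp: bounded_iff)

text \<open>A crude uniform bound, wanted for integrability.\<close>

lemma step1_error_bounded:
  assumes "\<And>k. \<bar>g k\<bar> \<le> B"
  shows "(step1_error g lam E w \<rho> Y)\<^sup>2 \<le> (real (card (triangles E)) * (B + 1))\<^sup>2"
proof -
  have "\<bar>step1_error g lam E w \<rho> Y\<bar> \<le> real (card (triangles E)) * (B + 1)"
    unfolding step1_error_def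
  proof (rule order_trans[OF sum_abs], rule sum_bounded_above)
    fix T
    show "\<bar>g (triangle_weight w T + Y (edge_pair (T - {\<rho> T}))) - biased_est lam (triangle_weight w T)\<bar> \<le> B + 1"
      using assms[of "triangle_weight w T + Y (edge_pair (T - {\<rho> T}))"]
      by (auto simp: biased_est_def)
  qed
  then show ?thesis by (metis abs_ge_zero power2_abs power_mono)
qed

text \<open>Given \<open>Y\<close>, the Laplace noise is centred and independent, so the conditional
  mean square is the squared step 1 error plus the noise variances. The 4 is the 2 of the Laplace
  variance times the 2 of the degree sum.\<close>

lemma expected_sq_error_le:
  assumes G: "weighted_graph n E w" and rho: "\<And>T. T \<in> triangles E \<Longrightarrow> \<rho> T \<in> T"
    and g: "finite (range g)" and K: "\<And>k k'. \<bar>g k - g k'\<bar> \<le> K" and "0 < \<epsilon>\<^sub>2"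
  shows "expected_sq_error (two_step_output g \<epsilon>\<^sub>1 \<epsilon>\<^sub>2 n E w \<rho>) (real (count_below E w lam)) \<le>
    ennreal (measure_pmf.expectation (step1_noise (exp (- \<epsilon>\<^sub>1)) E) (\<lambda>Y. (step1_error g lam E w \<rho> Y)\<^sup>2) +
      4 * K\<^sup>2 * (real (max_degree n E) / \<epsilon>\<^sub>2\<^sup>2 * real (card E)))"
proof -
  let ?P = "step1_noise (exp (- \<epsilon>\<^sub>1)) E" and ?c = "real (count_below E w lam)"
  let ?V = "4 * K\<^sup>2 * (real (max_degree n E) / \<epsilon>\<^sub>2\<^sup>2 * real (card E))"
  let ?f = "\<lambda>Y. local_fun E \<rho> g (noisy_weight w Y)"
  let ?b = "\<lambda>Y v. GS (nbhd E v) (?f Y v) / \<epsilon>\<^sub>2"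
  let ?A = "\<lambda>Y. \<Sum>v\<in>{1..n}. ?f Y v (restrict (w v) (nbhd E v))"
  let ?N = "\<lambda>Y. distr (\<Pi>\<^sub>M v\<in>{1..n}. Lap (?b Y v)) borel
    (\<lambda>L. \<Sum>v\<in>{1..n}. ?f Y v (restrict (w v) (nbhd E v)) + L v)"
  have b: "0 \<le> ?b Y v" for Y v
    using GS_local_fun(1)[OF G g K] assms(5) by simp
  have meas [measurable]: "(\<lambda>L. \<Sum>v\<in>{1..n}. ?f Y v (restrict (w v) (nbhd E v)) + L v) \<in>
      borel_measurable (\<Pi>\<^sub>M v\<in>{1..n}. Lap (?b Y v))" for Y
    by measurable
  \<comment> \<open>The noise scales depend on \<open>Y\<close>, but \<open>Y\<close> is discrete,
    so it suffices that every \<open>?N Y\<close> is a probability measure.\<close>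
  have N: "?N \<in> measurable (measure_pmf ?P) (subprob_algebra borel)"
  proof -
    have "prob_space (?N Y)" for Y
      by (intro prob_space.prob_space_distr prob_space_PiM prob_space_Lap b meas)
    then show ?thesis
      by (auto simp: space_subprob_algebra intro!: prob_space_imp_subprob_space)
  qed
  have noise: "(\<Sum>v\<in>{1..n}. 2 * (?b Y v)\<^sup>2) \<le> ?V" for Y
  proof -
    have "(\<Sum>v\<in>{1..n}. 2 * (?b Y v)\<^sup>2) \<le>
        (\<Sum>v\<in>{1..n}. 2 * (K * real (card (nbhd E v)) / \<epsilon>\<^sub>2)\<^sup>2)"
      using b GS_local_fun(2)[OF G g K] assms(5)
      by (intro sum_mono mult_left_mono power_mono divide_right_mono) auto
    also have "\<dots> = 2 * K\<^sup>2 / \<epsilon>\<^sub>2\<^sup>2 * real (\<Sum>v\<in>{1..n}. (card (nbhd E v))\<^sup>2)"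
      by (simp add: sum_distrib_left sum_divide_distrib power_mult_distrib power_divide mult_ac)
    also have "\<dots> \<le> 2 * K\<^sup>2 / \<epsilon>\<^sub>2\<^sup>2 * real (2 * max_degree n E * card E)"
      using sum_degree_sq_le[OF G] by (intro mult_left_mono) (auto simp only: of_nat_le_iff, simp)
    also have "\<dots> = ?V" by simp
    finally show ?thesis .
  qed
  obtain B where B: "\<And>k. \<bar>g k\<bar> \<le> B" using finite_range_bounded[OF g] by blast
  have err: "?A Y - ?c = step1_error g lam E w \<rho> Y" for Y
    using sum_local_fun[OF G rho] count_below_eq[OF G, of lam]
    by (simp add: step1_error_def sum_subtractf)
  have "expected_sq_error (two_step_output g \<epsilon>\<^sub>1 \<epsilon>\<^sub>2 n E w \<rho>) ?c =
      (\<integral>\<^sup>+Y. (\<integral>\<^sup>+x. ennreal ((x - ?c)\<^sup>2) \<partial>?N Y) \<partial>measure_pmf ?P)"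
    unfolding expected_sq_error_def two_step_output_def Let_def
    by (rule nn_integral_bind[OF _ N]) simp
  also have "\<dots> = (\<integral>\<^sup>+Y. ennreal ((step1_error g lam E w \<rho> Y)\<^sup>2 + (\<Sum>v\<in>{1..n}. 2 * (?b Y v)\<^sup>2)) \<partial>measure_pmf ?P)"
  proof (intro nn_integral_cong)
    fix Y
    have "(\<integral>\<^sup>+x. ennreal ((x - ?c)\<^sup>2) \<partial>?N Y) =
        (\<integral>\<^sup>+L. ennreal (((?A Y - ?c) + (\<Sum>v\<in>{1..n}. L v))\<^sup>2) \<partial>(\<Pi>\<^sub>M v\<in>{1..n}. Lap (?b Y v)))"
      by (subst nn_integral_distr[OF meas]) (simp_all add: sum.distrib algebra_simps)
    also have "\<dots> = ennreal ((?A Y - ?c)\<^sup>2 + (\<Sum>v\<in>{1..n}. 2 * (?b Y v)\<^sup>2))"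
      by (intro nn_integral_PiM_Lap_sq b) simp
    finally show "(\<integral>\<^sup>+x. ennreal ((x - ?c)\<^sup>2) \<partial>?N Y) =
        ennreal ((step1_error g lam E w \<rho> Y)\<^sup>2 + (\<Sum>v\<in>{1..n}. 2 * (?b Y v)\<^sup>2))"
      by (simp only: err)
  qed
  also have "\<dots> \<le> (\<integral>\<^sup>+Y. ennreal ((step1_error g lam E w \<rho> Y)\<^sup>2) + ennreal ?V \<partial>measure_pmf ?P)"
    using noise assms(5)
    by (intro nn_integral_mono) (simp flip: ennreal_plus add: ennreal_leI)
  also have "\<dots> = (\<integral>\<^sup>+Y. ennreal ((step1_error g lam E w \<rho> Y)\<^sup>2) \<partial>measure_pmf ?P) + ennreal ?V"
    by (subst nn_integral_add) (simp_all add: measure_pmf.emeasure_space_1)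
  also have "(\<integral>\<^sup>+Y. ennreal ((step1_error g lam E w \<rho> Y)\<^sup>2) \<partial>measure_pmf ?P) =
      ennreal (measure_pmf.expectation ?P (\<lambda>Y. (step1_error g lam E w \<rho> Y)\<^sup>2))"
    by (rule pmf_nn_integral_bounded[OF _ step1_error_bounded[OF B]]) simp
  also have "\<dots> + ennreal ?V = ennreal (measure_pmf.expectation ?P (\<lambda>Y. (step1_error g lam E w \<rho> Y)\<^sup>2) + ?V)"
    by (intro ennreal_plus[symmetric] integral_nonneg_AE) auto
  finally show ?thesis .
qed

section \<open>Step 1 error of the two estimators\<close>

lemma finite_noise_index:
  assumes G: "weighted_graph n E w"
  shows "finite {(v, u). {v, u} \<in> E}"
proof (rule finite_subset)
  show "{(v, u). {v, u} \<in> E} \<subseteq> {1..n} \<times> {1..n}"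
  proof clarify
    fix v u assume "{v, u} \<in> E"
    then have "{v, u} \<subseteq> {1..n}" using G unfolding weighted_graph_def by blast
    then show "v \<in> {1..n} \<and> u \<in> {1..n}" by simp
  qed
qed simp

lemma edge_eq_pair:
  assumes "weighted_graph n E w" "e \<in> E"
  shows "e = {fst (edge_pair e), snd (edge_pair e)}"
proof -
  have "card e = 2" using assms by (simp add: weighted_graph_def)
  then obtain a b where "e = {a, b}" by (auto simp: card_2_iff)
  then show ?thesis by (auto simp: edge_pair_def min_def max_def)
qed

text \<open>An edge is recovered from its pair, so distinct edges read distinct, hence independent,
  noise values.\<close>

lemma edge_pair_index:
  assumes G: "weighted_graph n E w"
  shows "inj_on edge_pair E" "edge_pair ` E \<subseteq> {(v, u). {v, u} \<in> E}"
proof -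
  show "inj_on edge_pair E"
    by (rule inj_onI) (metis edge_eq_pair[OF G])
  show "edge_pair ` E \<subseteq> {(v, u). {v, u} \<in> E}"
    using edge_eq_pair[OF G] by (auto simp: split_def)
qed

lemma biased_step1_error:
  assumes G: "weighted_graph n E w" and rho: "\<And>T. T \<in> triangles E \<Longrightarrow> \<rho> T \<in> T"
    and p: "0 < p" "p < 1"
  shows "measure_pmf.expectation (step1_noise p E) (\<lambda>Y. (step1_error (biased_est lam) lam E w \<rho> Y)\<^sup>2) \<le>
    2 * p * (real (card (triangles E)))\<^sup>2"
proof -
  let ?P = "step1_noise p E" and ?D = "triangles E"
  let ?e = "\<lambda>T. edge_pair (T - {\<rho> T})"
  let ?I = "indicator (- {0}) :: int \<Rightarrow> real"
  have int: "integrable (measure_pmf ?P) (\<lambda>Y. ?I (Y (?e T)))" for T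
    by (rule measure_pmf.integrable_const_bound[where B = 1]) (auto simp: indicator_def)
  have "\<bar>biased_est lam k\<bar> \<le> 1" for k by (simp add: biased_est_def)
  from step1_error_bounded[OF this]
  have int_err: "integrable (measure_pmf ?P) (\<lambda>Y. (step1_error (biased_est lam) lam E w \<rho> Y)\<^sup>2)"
    by (intro measure_pmf.integrable_const_bound[where B = "(real (card ?D) * (1 + 1))\<^sup>2"]) auto
  have "(step1_error (biased_est lam) lam E w \<rho> Y)\<^sup>2 \<le>
      (\<Sum>T\<in>?D. ?I (Y (?e T))) * card ?D" for Y
  proof -
    have "(step1_error (biased_est lam) lam E w \<rho> Y)\<^sup>2 \<le>
        (\<Sum>T\<in>?D. (biased_est lam (triangle_weight w T + Y (?e T)) -
          biased_est lam (triangle_weight w T))\<^sup>2) * card ?D"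
      unfolding step1_error_def by (rule sum_squared_le_sum_of_squares)
    \<comment> \<open>A triangle's error is -1, 0 or 1, and it is 0 when the noise on the opposite
      edge is 0.\<close>
    also have "\<dots> \<le> (\<Sum>T\<in>?D. ?I (Y (?e T))) * card ?D"
      by (intro mult_right_mono sum_mono) (auto simp: biased_est_def indicator_def)
    finally show ?thesis .
  qed
  then have "measure_pmf.expectation ?P (\<lambda>Y. (step1_error (biased_est lam) lam E w \<rho> Y)\<^sup>2) \<le>
      measure_pmf.expectation ?P (\<lambda>Y. (\<Sum>T\<in>?D. ?I (Y (?e T))) * card ?D)"
    by (intro integral_mono int_err Bochner_Integration.integrable_mult_left
        Bochner_Integration.integrable_sum int)
  also have "\<dots> = (\<Sum>T\<in>?D. measure_pmf.expectation ?P (\<lambda>Y. ?I (Y (?e T)))) * card ?D"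
    by (simp add: int)
  also have "\<dots> \<le> (\<Sum>T\<in>?D. 2 * p) * card ?D"
  proof (intro mult_right_mono sum_mono)
    fix T assume T: "T \<in> ?D"
    have "?e T \<in> {(v, u). {v, u} \<in> E}"
      by (rule subsetD[OF edge_pair_index(2)[OF G] imageI[OF opposite_edge(1)[OF G T rho[OF T]]]])
    then have "measure_pmf.expectation ?P (\<lambda>Y. ?I (Y (?e T))) =
        measure_pmf.expectation (DLap p) ?I"
      unfolding step1_noise_def
      by (rule expectation_Pi_pmf_component[OF finite_noise_index[OF G], where f = ?I])
    then show "measure_pmf.expectation ?P (\<lambda>Y. ?I (Y (?e T))) \<le> 2 * p"
      using prob_DLap_nonzero[OF p] by simp
  qed simp
  finally show ?thesis by (simp add: power2_eq_square mult_ac)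
qed

text \<open>Triangles with the same opposite edge share one noise value, so inside a class only
  Cauchy-Schwarz is available, at the price of a factor equal to the load. Across classes the
  centred sums are independent and their variances add.\<close>

lemma unbiased_step1_error:
  assumes G: "weighted_graph n E w" and rho: "\<And>T. T \<in> triangles E \<Longrightarrow> \<rho> T \<in> T"
    and p: "0 < p" "p < 1"
  shows "measure_pmf.expectation (step1_noise p E) (\<lambda>Y. (step1_error (unbiased_est p lam) lam E w \<rho> Y)\<^sup>2) \<le>
    (2 + 4 * (p / (1 - p)\<^sup>2)\<^sup>2 * (1 - p)) * real (\<Sum>e\<in>E. (opp_load E \<rho> e)\<^sup>2)"
proof -
  let ?D = "triangles E" and ?c = "p / (1 - p)\<^sup>2"
  let ?V = "2 + 4 * ?c\<^sup>2 * (1 - p)"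
  let ?x = "\<lambda>T y. unbiased_est p lam (triangle_weight w T + y) - biased_est lam (triangle_weight w T)"
  let ?D' = "\<lambda>e. {T \<in> ?D. T - {\<rho> T} = e}"
  let ?F = "\<lambda>e y. \<Sum>T\<in>?D' e. ?x T y"
  have c: "0 \<le> ?c" using p by simp
  have bnd: "\<bar>?x T y\<bar> \<le> 2 + ?c" for T y
    using c by (auto simp: unbiased_est_def biased_est_def)
  have F_bnd: "\<bar>?F e y\<bar> \<le> real (card ?D) * (2 + ?c)" for e y
  proof -
    have "\<bar>?F e y\<bar> \<le> real (card (?D' e)) * (2 + ?c)"
      by (rule order_trans[OF sum_abs]) (intro sum_bounded_above bnd)
    also have "\<dots> \<le> real (card ?D) * (2 + ?c)"
      using c finite_triangles[OF G] by (intro mult_right_mono of_nat_mono card_mono) auto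
    finally show ?thesis .
  qed
  have int: "integrable (measure_pmf (DLap p)) (?x T)" "integrable (measure_pmf (DLap p)) (\<lambda>y. (?x T y)\<^sup>2)"
    "integrable (measure_pmf (DLap p)) (\<lambda>y. unbiased_est p lam (triangle_weight w T + y))" for T
    subgoal using bnd by (intro measure_pmf.integrable_const_bound[where B = "2 + ?c"]) auto
    subgoal using power_mono[OF bnd abs_ge_zero, of _ _ 2]
      by (intro measure_pmf.integrable_const_bound[where B = "(2 + ?c)\<^sup>2"]) auto
    subgoal using c by (intro measure_pmf.integrable_const_bound[where B = "2 + ?c"])
        (auto simp: unbiased_est_def)
    done
  have mean: "measure_pmf.expectation (DLap p) (?F e) = 0" for e
    using int expectation_unbiased_est[OF p] by simp
  have var: "measure_pmf.expectation (DLap p) (\<lambda>y. (?F e y)\<^sup>2) \<le> ?V * real ((opp_load E \<rho> e)\<^sup>2)"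
    if e: "e \<in> E" for e
  proof -
    have "measure_pmf.expectation (DLap p) (\<lambda>y. (?F e y)\<^sup>2) \<le>
        measure_pmf.expectation (DLap p) (\<lambda>y. (\<Sum>T\<in>?D' e. (?x T y)\<^sup>2) * card (?D' e))"
      using power_mono[OF F_bnd abs_ge_zero, of _ _ 2]
      by (intro integral_mono sum_squared_le_sum_of_squares
          measure_pmf.integrable_const_bound[where B = "(real (card ?D) * (2 + ?c))\<^sup>2"]
          Bochner_Integration.integrable_mult_left Bochner_Integration.integrable_sum int) auto
    also have "\<dots> = (\<Sum>T\<in>?D' e. measure_pmf.expectation (DLap p) (\<lambda>y. (?x T y)\<^sup>2)) * card (?D' e)"
      by (simp add: int)
    also have "\<dots> \<le> (\<Sum>T\<in>?D' e. ?V) * card (?D' e)"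
      by (intro mult_right_mono sum_mono expectation_unbiased_est_sq p) simp
    also have "\<dots> = ?V * real ((opp_load E \<rho> e)\<^sup>2)"
      by (simp add: opp_load_eq[OF G rho e] power2_eq_square)
    finally show ?thesis .
  qed
  have "step1_error (unbiased_est p lam) lam E w \<rho> Y = (\<Sum>e\<in>E. ?F e (Y (edge_pair e)))" for Y
  proof -
    have "step1_error (unbiased_est p lam) lam E w \<rho> Y =
        (\<Sum>e\<in>E. \<Sum>T\<in>?D' e. ?x T (Y (edge_pair (T - {\<rho> T}))))"
      unfolding step1_error_def
      using finite_triangles[OF G] finite_edges[OF G] opposite_edge(1)[OF G] rho
      by (intro sum.group[symmetric]) auto
    also have "\<dots> = (\<Sum>e\<in>E. ?F e (Y (edge_pair e)))"
      by (intro sum.cong) auto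
    finally show ?thesis .
  qed
  then have "measure_pmf.expectation (step1_noise p E)
      (\<lambda>Y. (step1_error (unbiased_est p lam) lam E w \<rho> Y)\<^sup>2) =
      measure_pmf.expectation (step1_noise p E) (\<lambda>Y. (\<Sum>e\<in>E. ?F e (Y (edge_pair e)))\<^sup>2)"
    by simp
  also have "\<dots> = (\<Sum>e\<in>E. measure_pmf.expectation (DLap p) (\<lambda>y. (?F e y)\<^sup>2))"
    unfolding step1_noise_def
    by (rule expectation_Pi_pmf_sum_sq
        [OF finite_noise_index[OF G] finite_edges[OF G] edge_pair_index[OF G] F_bnd mean])
  also have "\<dots> \<le> (\<Sum>e\<in>E. ?V * real ((opp_load E \<rho> e)\<^sup>2))"
    by (intro sum_mono var)
  finally show ?thesis by (simp add: sum_distrib_left)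
qed

section \<open>Explicit constants\<close>

lemma biased_bound:
  assumes G: "weighted_graph n E w" and "0 < \<epsilon>\<^sub>1" "0 < \<epsilon>\<^sub>2" and greedy: "greedy_assignment E \<rho>"
  shows "expected_sq_error (two_step_output (biased_est lam) \<epsilon>\<^sub>1 \<epsilon>\<^sub>2 n E w \<rho>) (real (count_below E w lam))
    \<le> ennreal (4 * (real (max_degree n E) / \<epsilon>\<^sub>2\<^sup>2 * real (card E)
      + (real (card (triangles E)))\<^sup>2 / \<epsilon>\<^sub>1\<^sup>2 + real (C4_opt E) / \<epsilon>\<^sub>1))"
proof -
  let ?p = "exp (- \<epsilon>\<^sub>1)" and ?S = "(real (card (triangles E)))\<^sup>2"
  note rho = greedy_assignment_in[OF G greedy]
  have p: "0 < ?p" "?p < 1" using assms by auto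
  \<comment> \<open>The quadratic Taylor term turns the exponentially small \<open>2 * ?p\<close>
    into \<open>4 / \<epsilon>\<^sub>1\<^sup>2\<close>.\<close>
  have "1 + \<epsilon>\<^sub>1 + \<epsilon>\<^sub>1\<^sup>2 / 2 \<le> exp \<epsilon>\<^sub>1"
    using exp_lower_Taylor_quadratic[of \<epsilon>\<^sub>1] assms by simp
  then have "\<epsilon>\<^sub>1\<^sup>2 / 2 \<le> exp \<epsilon>\<^sub>1" using assms by linarith
  then have "2 * ?p \<le> 4 / \<epsilon>\<^sub>1\<^sup>2"
    using assms by (simp add: exp_minus field_simps)
  then have "2 * ?p * ?S \<le> 4 / \<epsilon>\<^sub>1\<^sup>2 * ?S" by (intro mult_right_mono) auto
  with biased_step1_error[OF G rho p, of lam]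
  have 1: "measure_pmf.expectation (step1_noise ?p E) (\<lambda>Y. (step1_error (biased_est lam) lam E w \<rho> Y)\<^sup>2)
      \<le> 4 * (?S / \<epsilon>\<^sub>1\<^sup>2)" by simp
  have fin: "finite (range (biased_est lam))"
    by (rule finite_subset[of _ "{0, 1}"]) (auto simp: biased_est_def)
  have K: "\<bar>biased_est lam k - biased_est lam k'\<bar> \<le> 1" for k k'
    by (simp add: biased_est_def)
  have "expected_sq_error (two_step_output (biased_est lam) \<epsilon>\<^sub>1 \<epsilon>\<^sub>2 n E w \<rho>) (real (count_below E w lam))
    \<le> ennreal (measure_pmf.expectation (step1_noise ?p E) (\<lambda>Y. (step1_error (biased_est lam) lam E w \<rho> Y)\<^sup>2) +
      4 * 1\<^sup>2 * (real (max_degree n E) / \<epsilon>\<^sub>2\<^sup>2 * real (card E)))"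
    by (rule expected_sq_error_le[OF G rho fin K assms(3)])
  also have "\<dots> \<le> ennreal (4 * (real (max_degree n E) / \<epsilon>\<^sub>2\<^sup>2 * real (card E)
      + ?S / \<epsilon>\<^sub>1\<^sup>2 + real (C4_opt E) / \<epsilon>\<^sub>1))"
  proof (rule ennreal_leI)
    have "0 \<le> real (C4_opt E) / \<epsilon>\<^sub>1" using assms by simp
    with 1 show "measure_pmf.expectation (step1_noise ?p E) (\<lambda>Y. (step1_error (biased_est lam) lam E w \<rho> Y)\<^sup>2) +
      4 * 1\<^sup>2 * (real (max_degree n E) / \<epsilon>\<^sub>2\<^sup>2 * real (card E)) \<le>
      4 * (real (max_degree n E) / \<epsilon>\<^sub>2\<^sup>2 * real (card E) + ?S / \<epsilon>\<^sub>1\<^sup>2 + real (C4_opt E) / \<epsilon>\<^sub>1)"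
      unfolding distrib_left power_one mult_1_right by linarith
  qed
  finally show ?thesis .
qed

lemma unbiased_est_bounds:
  assumes c: "c = p / (1 - p)\<^sup>2" and "0 \<le> c"
  shows "- c \<le> unbiased_est p lam k" "unbiased_est p lam k \<le> 1 + c"
  using assms(2) by (auto simp: unbiased_est_def c[symmetric])

text \<open>The oscillation \<open>K\<close> is at least one however large
  \<open>\<epsilon>\<^sub>1\<close> is, so powers of \<open>1 / \<epsilon>\<^sub>1\<close> can
  dominate it only on a bounded range; \<open>B\<close> fixes that range and enters
  \<open>C\<close>.\<close>

lemma unbiased_bound:
  assumes G: "weighted_graph n E w" and \<epsilon>: "0 < \<epsilon>\<^sub>1" "\<epsilon>\<^sub>1 \<le> B" "0 < \<epsilon>\<^sub>2" and greedy: "greedy_assignment E \<rho>"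
  defines "C \<equiv> 4 * (B\<^sup>2 + 2 * exp B)\<^sup>2 + 8 * (2 * B ^ 3 + 4 * (exp B)\<^sup>2)"
  shows "expected_sq_error (two_step_output (unbiased_est (exp (- \<epsilon>\<^sub>1)) lam) \<epsilon>\<^sub>1 \<epsilon>\<^sub>2 n E w \<rho>)
      (real (count_below E w lam))
    \<le> ennreal (C * (real (max_degree n E) / (\<epsilon>\<^sub>1 ^ 4 * \<epsilon>\<^sub>2\<^sup>2) * real (card E)
      + real (card (triangles E)) / \<epsilon>\<^sub>1 ^ 3 + real (C4_opt E) / \<epsilon>\<^sub>1 ^ 3))"
proof -
  let ?p = "exp (- \<epsilon>\<^sub>1)"
  let ?c = "?p / (1 - ?p)\<^sup>2" and ?M = "real (max_degree n E) / \<epsilon>\<^sub>2\<^sup>2 * real (card E)"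
  let ?S = "real (\<Sum>e\<in>E. (opp_load E \<rho> e)\<^sup>2)" and ?E = "exp B"
  let ?g = "unbiased_est ?p lam"
  let ?D = "real (card (triangles E))" and ?O = "real (C4_opt E)"
  \<comment> \<open>The estimator takes values in an interval from \<open>- ?c\<close> to
    \<open>1 + ?c\<close>.\<close>
  define K where "K = 1 + 2 * ?c"
  define V where "V = 2 + 4 * ?c\<^sup>2 * (1 - ?p)"
  note rho = greedy_assignment_in[OF G greedy]
  have p: "0 < ?p" "?p < 1" using \<epsilon> by auto
  have c0: "0 \<le> ?c" by simp
  have B: "0 < B" using \<epsilon> by simp
  \<comment> \<open>Gives \<open>1 - ?p \<ge> \<epsilon>\<^sub>1 * ?p\<close>, hence
    \<open>?c\<close> is of order \<open>1 / \<epsilon>\<^sub>1\<^sup>2\<close>. The opposite bound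
    \<open>1 - ?p \<le> \<epsilon>\<^sub>1\<close> below saves one power in
    \<open>V\<close>.\<close>
  have "1 + \<epsilon>\<^sub>1 \<le> exp \<epsilon>\<^sub>1" by (rule exp_ge_add_one_self)
  then have "(1 + \<epsilon>\<^sub>1) * ?p \<le> exp \<epsilon>\<^sub>1 * ?p" by (intro mult_right_mono) auto
  then have "\<epsilon>\<^sub>1 * ?p \<le> 1 - ?p" by (simp add: exp_minus algebra_simps)
  then have "(\<epsilon>\<^sub>1 * ?p)\<^sup>2 \<le> (1 - ?p)\<^sup>2" using \<epsilon> by (intro power_mono) auto
  then have "?c \<le> ?p / (\<epsilon>\<^sub>1 * ?p)\<^sup>2" using \<epsilon> p by (intro divide_left_mono) auto
  also have "\<dots> = exp \<epsilon>\<^sub>1 / \<epsilon>\<^sub>1\<^sup>2"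
    using \<epsilon> by (simp add: power2_eq_square exp_minus field_simps)
  also have "\<dots> \<le> ?E / \<epsilon>\<^sub>1\<^sup>2" using \<epsilon> by (intro divide_right_mono) auto
  finally have c: "?c \<le> ?E / \<epsilon>\<^sub>1\<^sup>2" .
  have q: "1 - ?p \<le> \<epsilon>\<^sub>1" using exp_ge_add_one_self[of "- \<epsilon>\<^sub>1"] by simp
  have K: "K\<^sup>2 \<le> (B\<^sup>2 + 2 * ?E)\<^sup>2 / \<epsilon>\<^sub>1 ^ 4"
  proof -
    \<comment> \<open>The additive 1 in \<open>K\<close> is absorbed through
      \<open>1 \<le> B\<^sup>2 / \<epsilon>\<^sub>1\<^sup>2\<close>; the 2 in \<open>V\<close> is
      treated likewise with cubes.\<close>
    have "\<epsilon>\<^sub>1\<^sup>2 \<le> B\<^sup>2" using \<epsilon> by (intro power_mono) auto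
    then have "1 \<le> B\<^sup>2 / \<epsilon>\<^sub>1\<^sup>2" using \<epsilon> by (simp add: field_simps)
    with c have "K \<le> (B\<^sup>2 + 2 * ?E) / \<epsilon>\<^sub>1\<^sup>2" by (simp add: K_def add_divide_distrib)
    then have "K\<^sup>2 \<le> ((B\<^sup>2 + 2 * ?E) / \<epsilon>\<^sub>1\<^sup>2)\<^sup>2" using c0 by (intro power_mono) (auto simp: K_def)
    then show ?thesis by (simp add: power_divide flip: power_mult)
  qed
  have V: "V \<le> (2 * B ^ 3 + 4 * ?E\<^sup>2) / \<epsilon>\<^sub>1 ^ 3"
  proof -
    have "\<epsilon>\<^sub>1 ^ 3 \<le> B ^ 3" using \<epsilon> by (intro power_mono) auto
    then have 1: "2 \<le> 2 * B ^ 3 / \<epsilon>\<^sub>1 ^ 3" using \<epsilon> by (simp add: field_simps)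
    have "?c\<^sup>2 * (1 - ?p) \<le> (?E / \<epsilon>\<^sub>1\<^sup>2)\<^sup>2 * \<epsilon>\<^sub>1"
      using c c0 q p \<epsilon> by (intro mult_mono power_mono) auto
    also have "\<dots> = ?E\<^sup>2 / \<epsilon>\<^sub>1 ^ 3"
      using \<epsilon> by (simp add: power2_eq_square power3_eq_cube)
    finally show ?thesis using 1 unfolding V_def add_divide_distrib by simp
  qed
  have "?S \<le> real (6 * card (triangles E) + 8 * C4_opt E)"
    using greedy_opp_load_sq[OF G greedy] by (simp only: of_nat_le_iff)
  then have S: "?S \<le> 8 * (?D + ?O)" by simp
  have "measure_pmf.expectation (step1_noise ?p E) (\<lambda>Y. (step1_error ?g lam E w \<rho> Y)\<^sup>2) \<le> V * ?S"
    unfolding V_def by (rule unbiased_step1_error[OF G rho p])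
  also have "\<dots> \<le> (2 * B ^ 3 + 4 * ?E\<^sup>2) / \<epsilon>\<^sub>1 ^ 3 * (8 * (?D + ?O))"
    using V S B \<epsilon> by (intro mult_mono) (auto intro!: sum_nonneg)
  finally have 1: "measure_pmf.expectation (step1_noise ?p E) (\<lambda>Y. (step1_error ?g lam E w \<rho> Y)\<^sup>2) \<le>
    8 * (2 * B ^ 3 + 4 * ?E\<^sup>2) * (?D / \<epsilon>\<^sub>1 ^ 3 + ?O / \<epsilon>\<^sub>1 ^ 3)"
    by (simp add: add_divide_distrib algebra_simps)
  have "4 * K\<^sup>2 * ?M \<le> 4 * ((B\<^sup>2 + 2 * ?E)\<^sup>2 / \<epsilon>\<^sub>1 ^ 4) * ?M"
    using K by (intro mult_right_mono mult_left_mono) auto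
  also have "\<dots> = 4 * (B\<^sup>2 + 2 * ?E)\<^sup>2 * (real (max_degree n E) / (\<epsilon>\<^sub>1 ^ 4 * \<epsilon>\<^sub>2\<^sup>2) * real (card E))"
    by simp
  finally have 2: "4 * K\<^sup>2 * ?M \<le> \<dots>" .
  have fin: "finite (range ?g)"
    by (rule finite_subset[of _ "{0, - ?c, 1 + ?c, 1}"]) (auto simp: unbiased_est_def)
  have g: "\<bar>?g k - ?g k'\<bar> \<le> K" for k k'
    using unbiased_est_bounds[OF refl c0, of lam k] unbiased_est_bounds[OF refl c0, of lam k']
    unfolding K_def by linarith
  have "expected_sq_error (two_step_output ?g \<epsilon>\<^sub>1 \<epsilon>\<^sub>2 n E w \<rho>) (real (count_below E w lam))
    \<le> ennreal (measure_pmf.expectation (step1_noise ?p E) (\<lambda>Y. (step1_error ?g lam E w \<rho> Y)\<^sup>2) +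
      4 * K\<^sup>2 * ?M)"
    by (rule expected_sq_error_le[OF G rho fin g \<epsilon>(3)])
  also have "\<dots> \<le> ennreal (8 * (2 * B ^ 3 + 4 * ?E\<^sup>2) * (?D / \<epsilon>\<^sub>1 ^ 3 + ?O / \<epsilon>\<^sub>1 ^ 3) +
      4 * (B\<^sup>2 + 2 * ?E)\<^sup>2 * (real (max_degree n E) / (\<epsilon>\<^sub>1 ^ 4 * \<epsilon>\<^sub>2\<^sup>2) * real (card E)))"
    by (intro ennreal_leI add_mono 1 2)
  \<comment> \<open>\<open>C\<close> is the sum of the two coefficients, so it dominates
    each.\<close>
  also have "\<dots> \<le> ennreal (C * (?D / \<epsilon>\<^sub>1 ^ 3 + ?O / \<epsilon>\<^sub>1 ^ 3) +
      C * (real (max_degree n E) / (\<epsilon>\<^sub>1 ^ 4 * \<epsilon>\<^sub>2\<^sup>2) * real (card E)))"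
    using B \<epsilon> by (intro ennreal_leI add_mono mult_right_mono) (auto simp: C_def)
  finally show ?thesis by (simp add: algebra_simps)
qed

theorem mainTheorem8:
  shows
    "(\<exists>C>0. \<forall>(n::nat) (E::nat set set) (w::nat \<Rightarrow> nat \<Rightarrow> int) (lam::int) (\<epsilon>\<^sub>1::real) (\<epsilon>\<^sub>2::real)
        (\<rho>::nat set \<Rightarrow> nat).
        weighted_graph n E w \<longrightarrow> \<epsilon>\<^sub>1 > 0 \<longrightarrow> \<epsilon>\<^sub>2 > 0 \<longrightarrow> greedy_assignment E \<rho> \<longrightarrow>
        expected_sq_error
          (two_step_output (biased_est lam) \<epsilon>\<^sub>1 \<epsilon>\<^sub>2 n E w \<rho>) (real (count_below E w lam))
        \<le> ennreal (C * (real (max_degree n E) / \<epsilon>\<^sub>2\<^sup>2 * real (card E)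
              + (real (card (triangles E)))\<^sup>2 / \<epsilon>\<^sub>1\<^sup>2
              + real (C4_opt E) / \<epsilon>\<^sub>1)))
     \<and>
     (\<forall>B>0. \<exists>C>0. \<forall>(n::nat) (E::nat set set) (w::nat \<Rightarrow> nat \<Rightarrow> int) (lam::int) (\<epsilon>\<^sub>1::real) (\<epsilon>\<^sub>2::real)
        (\<rho>::nat set \<Rightarrow> nat).
        weighted_graph n E w \<longrightarrow> 0 < \<epsilon>\<^sub>1 \<and> \<epsilon>\<^sub>1 \<le> B \<longrightarrow> \<epsilon>\<^sub>2 > 0 \<longrightarrow> greedy_assignment E \<rho> \<longrightarrow>
        expected_sq_error
          (two_step_output (unbiased_est (exp (- \<epsilon>\<^sub>1)) lam) \<epsilon>\<^sub>1 \<epsilon>\<^sub>2 n E w \<rho>) (real (count_below E w lam))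
        \<le> ennreal (C * (real (max_degree n E) / (\<epsilon>\<^sub>1 ^ 4 * \<epsilon>\<^sub>2\<^sup>2) * real (card E)
              + real (card (triangles E)) / \<epsilon>\<^sub>1 ^ 3
              + real (C4_opt E) / \<epsilon>\<^sub>1 ^ 3)))"
proof (intro conjI allI impI)
  show "\<exists>C>0. \<forall>n E w lam \<epsilon>\<^sub>1 \<epsilon>\<^sub>2 \<rho>. weighted_graph n E w \<longrightarrow> \<epsilon>\<^sub>1 > 0 \<longrightarrow> \<epsilon>\<^sub>2 > 0 \<longrightarrow>
      greedy_assignment E \<rho> \<longrightarrow>
      expected_sq_error
        (two_step_output (biased_est lam) \<epsilon>\<^sub>1 \<epsilon>\<^sub>2 n E w \<rho>) (real (count_below E w lam))
      \<le> ennreal (C * (real (max_degree n E) / \<epsilon>\<^sub>2\<^sup>2 * real (card E)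
            + (real (card (triangles E)))\<^sup>2 / \<epsilon>\<^sub>1\<^sup>2
            + real (C4_opt E) / \<epsilon>\<^sub>1))"
    by (intro exI[of _ 4] conjI allI impI biased_bound) auto
next
  fix B :: real assume "0 < B"
  then have "0 < 4 * (B\<^sup>2 + 2 * exp B)\<^sup>2 + 8 * (2 * B ^ 3 + 4 * (exp B)\<^sup>2)"
    by (intro add_nonneg_pos mult_pos_pos add_pos_pos) auto
  then show "\<exists>C>0. \<forall>n E w lam \<epsilon>\<^sub>1 \<epsilon>\<^sub>2 \<rho>. weighted_graph n E w \<longrightarrow> 0 < \<epsilon>\<^sub>1 \<and> \<epsilon>\<^sub>1 \<le> B \<longrightarrow>
      \<epsilon>\<^sub>2 > 0 \<longrightarrow> greedy_assignment E \<rho> \<longrightarrow>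
      expected_sq_error
        (two_step_output (unbiased_est (exp (- \<epsilon>\<^sub>1)) lam) \<epsilon>\<^sub>1 \<epsilon>\<^sub>2 n E w \<rho>) (real (count_below E w lam))
      \<le> ennreal (C * (real (max_degree n E) / (\<epsilon>\<^sub>1 ^ 4 * \<epsilon>\<^sub>2\<^sup>2) * real (card E)
            + real (card (triangles E)) / \<epsilon>\<^sub>1 ^ 3
            + real (C4_opt E) / \<epsilon>\<^sub>1 ^ 3))"
    by (intro exI[of _ "4 * (B\<^sup>2 + 2 * exp B)\<^sup>2 + 8 * (2 * B ^ 3 + 4 * (exp B)\<^sup>2)"]
        conjI allI impI unbiased_bound) auto
qed

end
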